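(* Let $X=(X_t)_{t\in[0,1]}$ be a real-valued, nondeterministic $(\nu,\sigma^2,b)$-Lévy process under the probability measure $\mathbb{P}$ whose Lévy measure $\nu$ has support in $\{|x|\le 1\}$. Let $$\Lambda(u):=\frac12\sigma^2u^2+bu+\int\left[e^{ux}-1-ux\right]\nu(dx),\qquad u\in\mathbb{R},$$ denote the logarithmic moment generating function of $X_1$, and assume that $u^*\in\mathbb{R}$ is a solution of $\Lambda'(u^* )=0$. Then the Esscher transform $\mathbb{Q}$ given by $$\frac{d\mathbb{Q}}{d\mathbb{P}}=e^{u^*X_1-\Lambda(u^* )}$$ is a probability measure such that, for all $\varepsilon>0$, $$e^{\Lambda(u^* )-\varepsilon|u^*|}\,\mathbb{Q}(\|X\|\le\varepsilon)\le\mathbb{P}(\|X\|\le\varepsilon)\le e^{\Lambda(u^* )+\varepsilon|u^*|}\,\mathbb{Q}(\|X\|\le\varepsilon),$$ and $X$ is an $(e^{u^*x}\cdot\nu(dx),\sigma^2)$-Lévy martingale under $\mathbb{Q}$.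
   Context: $\|X\|:=\sup_{t\in[0,1]}|X_t|$. A $(\nu,\sigma^2,b)$-Lévy process $X=(X_t)_{t\in[0,1]}$ is a process with independent stationary increments, $X_0=0$, stochastic continuity and càdlàg paths such that $\mathbb{E}e^{iuX_t}=e^{-t\psi(u)}$ with $$\psi(u)=\frac{\sigma^2}{2}u^2-ibu+\int_{\mathbb{R}\setminus\{0\}}\left(1-e^{iux}+\mathbf 1_{\{|x|\le1\}}iux\right)\nu(dx),$$ where $\sigma^2\in[0,\infty)$, $b\in\mathbb{R}$ and $\nu$ (the Lévy measure) is a positive measure on $\mathbb{R}\setminus\{0\}$ with $\int 1\wedge x^2\,\nu(dx)<\infty$. For a positive measure $\mu$ on $\mathbb{R}\setminus\{0\}$ with $\int|x|\wedge x^2\,\mu(dx)<\infty$, a Lévy process is called a $(\mu,\sigma^2)$-Lévy martingale if its characteristic function is $e^{-t\psi(u)}$ with $\psi(u)=\frac{\sigma^2}{2}u^2+\int_{\mathbb{R}\setminus\{0\}}(1-e^{iux}+iux)\,\mu(dx)$. The notation $e^{u^*x}\cdot\nu(dx)$ denotes the measure with density $x\mapsto e^{u^*x}$ with respect to $\nu$. *)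

theory Defs
  imports "HOL-Probability.Probability"
begin

definition cadlag_on_unit_interval :: "(real \<Rightarrow> real) \<Rightarrow> bool" where
  "cadlag_on_unit_interval f \<longleftrightarrow>
     (\<forall>t\<in>{0..<1}. (f \<longlongrightarrow> f t) (at_right t)) \<and>
     (\<forall>t\<in>{0<..1}. \<exists>l. (f \<longlongrightarrow> l) (at_left t))"

text \<open>
  Processes indexed by \<open>[0,1]\<close> are total functions of a real time parameter; their values at times
  outside \<open>[0,1]\<close> are irrelevant.
\<close>

locale levy_process = prob_space M for M :: "'a measure" +
  fixes X :: "real \<Rightarrow> 'a \<Rightarrow> real"
  assumes random_variables: "\<And>t. t \<in> {0..1} \<Longrightarrow> X t \<in> borel_measurable M"
    and start_zero: "\<And>\<omega>. \<omega> \<in> space M \<Longrightarrow> X 0 \<omega> = 0"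
    and independent_increments:
      "\<And>(n::nat) (t::nat \<Rightarrow> real). \<lbrakk>0 \<le> t 0; \<forall>i<n. t i \<le> t (Suc i); t n \<le> 1\<rbrakk> \<Longrightarrow>
         indep_vars (\<lambda>_. borel) (\<lambda>i \<omega>. X (t (Suc i)) \<omega> - X (t i) \<omega>) {..<n}"
    and stationary_increments:
      "\<And>s h. \<lbrakk>0 \<le> s; 0 \<le> h; s + h \<le> 1\<rbrakk> \<Longrightarrow>
         distr M borel (\<lambda>\<omega>. X (s + h) \<omega> - X s \<omega>) = distr M borel (\<lambda>\<omega>. X h \<omega> - X 0 \<omega>)"
    and stochastically_continuous:
      "\<And>t \<epsilon>. \<lbrakk>t \<in> {0..1}; 0 < \<epsilon>\<rbrakk> \<Longrightarrow>
         ((\<lambda>s. measure M {\<omega> \<in> space M. \<epsilon> < \<bar>X s \<omega> - X t \<omega>\<bar>}) \<longlongrightarrow> 0) (at t within {0..1})"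
    and cadlag_paths: "\<And>\<omega>. \<omega> \<in> space M \<Longrightarrow> cadlag_on_unit_interval (\<lambda>t. X t \<omega>)"

text \<open>
  A positive measure on \<open>\<real> - {0}\<close> is encoded as a Borel measure on \<open>\<real>\<close> that does not charge \<open>{0}\<close>,
  so that integrals over \<open>\<real> - {0}\<close> are integrals over the whole line.
\<close>

definition measure_off_zero :: "real measure \<Rightarrow> bool" where
  "measure_off_zero \<nu> \<longleftrightarrow> sets \<nu> = sets borel \<and> emeasure \<nu> {0} = 0"

definition levy_exponent :: "real measure \<Rightarrow> real \<Rightarrow> real \<Rightarrow> real \<Rightarrow> complex" where
  "levy_exponent \<nu> \<sigma>2 b u =
     of_real (\<sigma>2 / 2 * u\<^sup>2) - \<i> * of_real (b * u) +
     (CLINT x|\<nu>. 1 - iexp (u * x) + indicator {x. \<bar>x\<bar> \<le> 1} x * (\<i> * of_real (u * x)))"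

definition levy_martingale_exponent :: "real measure \<Rightarrow> real \<Rightarrow> real \<Rightarrow> complex" where
  "levy_martingale_exponent \<mu> \<sigma>2 u =
     of_real (\<sigma>2 / 2 * u\<^sup>2) + (CLINT x|\<mu>. 1 - iexp (u * x) + \<i> * of_real (u * x))"

text \<open>The parameter \<open>\<sigma>2\<close> is the variance \<open>\<sigma>\<^sup>2\<close> itself, not its square root.\<close>

locale levy_process_with_triplet = levy_process M X
  for M :: "'a measure" and X :: "real \<Rightarrow> 'a \<Rightarrow> real" +
  fixes \<nu> :: "real measure" and \<sigma>2 b :: real
  assumes levy_measure: "measure_off_zero \<nu>" "(\<integral>\<^sup>+x. ennreal (min 1 (x\<^sup>2)) \<partial>\<nu>) < \<infinity>"
    and variance_nonneg: "0 \<le> \<sigma>2"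
    and char_function:
      "\<And>t u. t \<in> {0..1} \<Longrightarrow>
         char (distr M borel (X t)) u = exp (- (of_real t * levy_exponent \<nu> \<sigma>2 b u))"

locale levy_martingale = levy_process M X
  for M :: "'a measure" and X :: "real \<Rightarrow> 'a \<Rightarrow> real" +
  fixes \<mu> :: "real measure" and \<sigma>2 :: real
  assumes levy_measure: "measure_off_zero \<mu>" "(\<integral>\<^sup>+x. ennreal (min \<bar>x\<bar> (x\<^sup>2)) \<partial>\<mu>) < \<infinity>"
    and variance_nonneg: "0 \<le> \<sigma>2"
    and char_function:
      "\<And>t u. t \<in> {0..1} \<Longrightarrow>
         char (distr M borel (X t)) u = exp (- (of_real t * levy_martingale_exponent \<mu> \<sigma>2 u))"

definition deterministic_process :: "'a measure \<Rightarrow> (real \<Rightarrow> 'a \<Rightarrow> real) \<Rightarrow> bool" where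
  "deterministic_process M X \<longleftrightarrow> (\<exists>f. \<forall>t\<in>{0..1}. AE \<omega> in M. X t \<omega> = f t)"

definition measure_support :: "real measure \<Rightarrow> real set" where
  "measure_support \<nu> = {x. \<forall>U. open U \<longrightarrow> x \<in> U \<longrightarrow> 0 < emeasure \<nu> U}"

definition levy_log_mgf :: "real measure \<Rightarrow> real \<Rightarrow> real \<Rightarrow> real \<Rightarrow> real" where
  "levy_log_mgf \<nu> \<sigma>2 b u =
     1 / 2 * \<sigma>2 * u\<^sup>2 + b * u + (LINT x|\<nu>. exp (u * x) - 1 - u * x)"

text \<open>For cadlag paths the supremum is over a bounded set, hence a genuine one.\<close>

definition sup_norm :: "(real \<Rightarrow> 'a \<Rightarrow> real) \<Rightarrow> 'a \<Rightarrow> real" where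
  "sup_norm X \<omega> = (SUP t\<in>{0..1}. \<bar>X t \<omega>\<bar>)"

end

theory Submission
  imports Defs "HOL-Complex_Analysis.Complex_Analysis"
begin

text \<open>
  Since \<open>\<nu>\<close> has bounded support, the exponent extends to an entire function \<open>\<Lambda>\<close> with
  \<open>Re (\<Lambda> z) \<le> \<Lambda> (Re z)\<close>. Damping the law of \<open>X t\<close> by a Gaussian factor \<open>exp (- \<delta>\<^sup>2 x\<^sup>2 / 2)\<close> makes its
  moment generating function entire, and the identity theorem expresses it as a Gaussian average
  of \<open>exp (t \<Lambda>)\<close> along a vertical line; the bound on \<open>Re \<Lambda>\<close> keeps this average under control as
  \<open>\<delta> \<rightarrow> 0\<close>, so all exponential moments exist and \<open>E exp (z X t) = exp (t \<Lambda> z)\<close> for all complex \<open>z\<close>.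
  The Esscher density is a product over increments, so it preserves their independence and
  tilts each law separately; the tilted exponent is \<open>\<Lambda> (u + i v) - \<Lambda> u\<close>, whose drift term
  vanishes because \<open>\<Lambda>' u = 0\<close>. Finally, \<open>\<bar>X 1\<bar> \<le> \<epsilon>\<close> on the small ball, so there the density
  is \<open>exp (- \<Lambda> u)\<close> up to a factor \<open>exp (\<plusminus> \<epsilon> \<bar>u\<bar>)\<close>.
\<close>

subsection \<open>Characteristic functions with an entire ridge extension\<close>

text \<open>Cauchy's inequality turns the bound on \<open>f\<close> over a disc into a bound on its
  derivative over a smaller one. The difference quotients are therefore dominated by the same
  \<open>g\<close>, and no separate bound on the derivative has to be supplied.\<close>

lemma has_field_derivative_lebesgue_integral:
  fixes f :: "complex \<Rightarrow> 'a \<Rightarrow> complex"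
  assumes meas: "\<And>z. f z \<in> borel_measurable M"
    and hol: "\<And>x. x \<in> space M \<Longrightarrow> (\<lambda>z. f z x) holomorphic_on UNIV"
    and bound: "\<And>R. \<exists>g::'a \<Rightarrow> real. integrable M g \<and> (AE x in M. \<forall>z. norm z \<le> R \<longrightarrow> norm (f z x) \<le> g x)"
  shows "((\<lambda>z. LINT x|M. f z x) has_field_derivative (LINT x|M. deriv (\<lambda>z. f z x) a)) (at a)"
proof -
  \<comment> \<open>The margin 2 is one unit for the increment \<open>h\<close> and one for the
    Cauchy circle around a point of the unit disc at \<open>a\<close>.\<close>
  obtain g :: "'a \<Rightarrow> real" where g: "integrable M g"
    and fg: "AE x in M. \<forall>z. norm z \<le> norm a + 2 \<longrightarrow> norm (f z x) \<le> g x"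
    using bound by blast
  have int: "integrable M (f z)" if "norm z \<le> norm a + 2" for z
    using fg that by (intro Bochner_Integration.integrable_bound[OF g meas]) (auto elim!: eventually_mono intro: order_trans[OF _ abs_ge_self])
  have der: "((\<lambda>z. f z x) has_field_derivative deriv (\<lambda>z. f z x) z) (at z)" if "x \<in> space M" for x z
    using hol[OF that] by (simp add: holomorphic_derivI)
  have lip: "AE x in M. \<forall>h. norm h \<le> 1 \<longrightarrow> norm (f (a + h) x - f a x) \<le> g x * norm h"
    using fg AE_space
  proof eventually_elim
    case (elim x)
    have "norm (deriv (\<lambda>z. f z x) w) \<le> g x" if "w \<in> cball a 1" for w
    proof -
      have "norm ((deriv ^^ 1) (\<lambda>z. f z x) w) \<le> fact 1 * g x / 1 ^ 1"
      proof (rule Cauchy_inequality)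
        show "(\<lambda>z. f z x) holomorphic_on ball w 1"
          using hol[OF elim(2)] holomorphic_on_subset by blast
        show "continuous_on (cball w 1) (\<lambda>z. f z x)"
          using hol[OF elim(2)] holomorphic_on_imp_continuous_on continuous_on_subset by blast
        fix z assume z: "norm (w - z) = 1"
        have "norm z = norm (a + (w - a) + (z - w))" by simp
        also have "\<dots> \<le> norm (a + (w - a)) + norm (z - w)" by (rule norm_triangle_ineq)
        also have "\<dots> \<le> norm a + norm (w - a) + norm (z - w)"
          using norm_triangle_ineq[of a "w - a"] by simp
        also have "\<dots> \<le> norm a + 2"
          using that z by (simp add: dist_norm norm_minus_commute)
        finally show "norm (f z x) \<le> g x" using elim by simp
      qed simp
      then show ?thesis by simp
    qed
    then have "norm (f (a + h) x - f a x) \<le> g x * norm (a + h - a)" if "norm h \<le> 1" for h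
      using der[OF elim(2)] that
      by (intro field_differentiable_bound[of "cball a 1" "\<lambda>z. f z x" "deriv (\<lambda>z. f z x)"])
        (auto simp: dist_norm intro: has_field_derivative_at_within)
    then show ?case by simp
  qed
  show ?thesis
    unfolding has_field_derivative_iff tendsto_at_iff_sequentially comp_def
  proof (intro allI impI)
    fix h :: "nat \<Rightarrow> complex"
    assume "\<forall>i. h i \<in> UNIV - {a}" "h \<longlonglongrightarrow> a"
    then have ha: "h i \<noteq> a" for i by simp
    define k where "k i = h i - a" for i
    have k: "h i = a + k i" "k i \<noteq> 0" for i using ha by (auto simp: k_def)
    have k0: "k \<longlonglongrightarrow> 0"
      unfolding k_def using \<open>h \<longlonglongrightarrow> a\<close> by (simp add: LIM_zero_iff)
    then obtain N where N: "\<And>i. i \<ge> N \<Longrightarrow> norm (k i) \<le> 1"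
      using LIMSEQ_D[of k 0 1] by (auto dest: less_imp_le)
    let ?q = "\<lambda>i x. (f (a + k i) x - f a x) / k i"
    have lim: "(\<lambda>i. ?q i x) \<longlonglongrightarrow> deriv (\<lambda>z. f z x) a" if "x \<in> space M" for x
    proof -
      have "((\<lambda>y. (f y x - f a x) / (y - a)) \<longlongrightarrow> deriv (\<lambda>z. f z x) a) (at a)"
        using der[OF that] unfolding has_field_derivative_iff .
      then have "(\<lambda>i. (f (h i) x - f a x) / (h i - a)) \<longlonglongrightarrow> deriv (\<lambda>z. f z x) a"
        using \<open>\<forall>i. h i \<in> UNIV - {a}\<close> \<open>h \<longlonglongrightarrow> a\<close>
        unfolding tendsto_at_iff_sequentially comp_def by blast
      then show ?thesis by (simp add: k(1))
    qed
    have mq: "?q i \<in> borel_measurable M" for i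
      using meas by measurable
    \<comment> \<open>Dominated convergence works along sequences and needs increments of norm at
      most 1 throughout. The shift by \<open>N\<close> discards the earlier terms.\<close>
    have "(\<lambda>i. LINT x|M. ?q (i + N) x) \<longlonglongrightarrow> (LINT x|M. deriv (\<lambda>z. f z x) a)"
    proof (rule integral_dominated_convergence)
      \<comment> \<open>The derivative is measurable in \<open>x\<close> as a pointwise limit of
        measurable quotients.\<close>
      show "(\<lambda>x. deriv (\<lambda>z. f z x) a) \<in> borel_measurable M"
        by (rule borel_measurable_LIMSEQ_metric[OF mq lim])
      show "AE x in M. (\<lambda>i. ?q (i + N) x) \<longlonglongrightarrow> deriv (\<lambda>z. f z x) a"
        by (rule AE_I2) (rule LIMSEQ_ignore_initial_segment[OF lim])
      show "AE x in M. norm (?q (i + N) x) \<le> g x" for i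
        using lip by eventually_elim
          (use N[of "i + N"] k(2) in \<open>auto simp: norm_divide pos_divide_le_eq\<close>)
    qed (use g mq in auto)
    moreover have "(LINT x|M. ?q (i + N) x) =
        ((LINT x|M. f (h (i + N)) x) - (LINT x|M. f a x)) / (h (i + N) - a)" for i
    proof -
      have "norm (a + k (i + N)) \<le> norm a + 2"
        using N[of "i + N"] norm_triangle_ineq[of a "k (i + N)"] by simp
      then show ?thesis by (simp add: k(1) int)
    qed
    ultimately have "(\<lambda>i. ((LINT x|M. f (h (i + N)) x) - (LINT x|M. f a x)) / (h (i + N) - a))
        \<longlonglongrightarrow> (LINT x|M. deriv (\<lambda>z. f z x) a)" by simp
    then show "(\<lambda>i. ((LINT x|M. f (h i) x) - (LINT x|M. f a x)) / (h i - a))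
        \<longlonglongrightarrow> (LINT x|M. deriv (\<lambda>z. f z x) a)"
      by (rule LIMSEQ_offset)
  qed
qed

lemma holomorphic_on_lebesgue_integral:
  fixes f :: "complex \<Rightarrow> 'a \<Rightarrow> complex"
  assumes "\<And>z. f z \<in> borel_measurable M"
    and "\<And>x. x \<in> space M \<Longrightarrow> (\<lambda>z. f z x) holomorphic_on UNIV"
    and "\<And>R. \<exists>g::'a \<Rightarrow> real. integrable M g \<and> (AE x in M. \<forall>z. norm z \<le> R \<longrightarrow> norm (f z x) \<le> g x)"
  shows "(\<lambda>z. LINT x|M. f z x) holomorphic_on UNIV"
  using has_field_derivative_lebesgue_integral[OF assms]
  by (auto simp: holomorphic_on_open)

lemma imaginary_axis_islimpt: "0 islimpt range (\<lambda>s. \<i> * complex_of_real s)"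
proof (rule islimptI)
  fix T :: "complex set" assume "0 \<in> T" "open T"
  then obtain e where e: "e > 0" "ball 0 e \<subseteq> T" using open_contains_ball by blast
  then show "\<exists>y\<in>range (\<lambda>s. \<i> * complex_of_real s). y \<in> T \<and> y \<noteq> 0"
    by (intro bexI[of _ "\<i> * complex_of_real (e/2)"] conjI rangeI) (auto simp: norm_mult subset_iff)
qed

text \<open>The imaginary axis accumulates at 0, so the identity theorem applies to
  \<open>f - g\<close>.\<close>

lemma entire_eq_if_eq_on_imaginary_axis:
  assumes "f holomorphic_on UNIV" "g holomorphic_on UNIV"
    and "\<And>s. f (\<i> * complex_of_real s) = g (\<i> * complex_of_real s)"
  shows "f z = g z"
proof -
  have "f z - g z = 0"
  proof (rule analytic_continuation[where f = "\<lambda>z. f z - g z"])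
    show "(\<lambda>z. f z - g z) holomorphic_on UNIV"
      using assms by (intro holomorphic_intros)
    show "0 islimpt range (\<lambda>s. \<i> * complex_of_real s)" by (rule imaginary_axis_islimpt)
  qed (use assms in auto)
  then show ?thesis by simp
qed

section \<open>Exponential moments by Gaussian damping\<close>

context real_distribution
begin

text \<open>The function \<open>\<Phi>\<close> is a candidate for the moment generating function,
  known to be right only on the imaginary axis. The condition \<open>ridge\<close> bounds it on each
  vertical line by its modulus at the real point, uniformly in the imaginary part.\<close>

context
  fixes \<Phi> :: "complex \<Rightarrow> complex"
  assumes entire: "\<Phi> holomorphic_on UNIV"
    and ridge: "\<And>z. norm (\<Phi> z) \<le> norm (\<Phi> (of_real (Re z)))"
    and char_eq: "\<And>v. char M v = \<Phi> (\<i> * of_real v)"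
begin

text \<open>Both sides are entire in \<open>z\<close>; on the imaginary axis they agree by Fubini, the Gaussian weight
  being the characteristic function of \<open>\<delta>\<close> times a standard normal variable.\<close>

lemma gaussian_damped_mgf:
  assumes "\<delta> \<noteq> 0"
  shows "(LINT x|M. exp (z * of_real x - of_real (\<delta>\<^sup>2 * x\<^sup>2 / 2))) =
         (LINT v|std_normal_distribution. \<Phi> (z + \<i> * of_real (\<delta> * v)))" (is "?A z = ?B z")
proof (rule entire_eq_if_eq_on_imaginary_axis[of ?A ?B])
  interpret N: real_distribution std_normal_distribution
    by (rule real_dist_normal_dist)
  interpret MN: pair_prob_space M std_normal_distribution ..
  have cont: "continuous_on UNIV \<Phi>"
    using entire by (rule holomorphic_on_imp_continuous_on)
  show "?A holomorphic_on UNIV"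
  proof (rule holomorphic_on_lebesgue_integral)
    fix R :: real
    \<comment> \<open>Completing the square beats the linear exponent by the Gaussian one. The bound
      does not depend on \<open>x\<close>, and a constant is integrable under a probability
      measure.\<close>
    have "norm (exp (z * of_real x - of_real (\<delta>\<^sup>2 * x\<^sup>2 / 2))) \<le> exp (R\<^sup>2 / (2 * \<delta>\<^sup>2))"
      if "norm z \<le> R" for z :: complex and x :: real
    proof -
      have "Re z * x \<le> \<bar>Re z\<bar> * \<bar>x\<bar>" by (metis abs_ge_self abs_mult)
      also have "\<dots> \<le> R * \<bar>x\<bar>"
        using abs_Re_le_cmod[of z] that by (intro mult_right_mono) auto
      also have "R * \<bar>x\<bar> \<le> R\<^sup>2 / (2 * \<delta>\<^sup>2) + \<delta>\<^sup>2 * x\<^sup>2 / 2"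
      proof -
        have "0 \<le> (R / \<delta> - \<delta> * \<bar>x\<bar>)\<^sup>2" by simp
        also have "\<dots> = R\<^sup>2 / \<delta>\<^sup>2 + \<delta>\<^sup>2 * x\<^sup>2 - 2 * (R * \<bar>x\<bar>)"
          using assms by (simp add: power2_diff power_divide power_mult_distrib)
        finally show ?thesis by (simp add: field_simps)
      qed
      finally show ?thesis by simp
    qed
    then show "\<exists>g::real \<Rightarrow> real. integrable M g \<and>
        (AE x in M. \<forall>z::complex. norm z \<le> R \<longrightarrow> norm (exp (z * of_real x - of_real (\<delta>\<^sup>2 * x\<^sup>2 / 2))) \<le> g x)"
      by (intro exI[of _ "\<lambda>_. exp (R\<^sup>2 / (2 * \<delta>\<^sup>2))"]) auto
  qed (auto intro!: holomorphic_intros)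
  show "?B holomorphic_on UNIV"
  proof (rule holomorphic_on_lebesgue_integral)
    fix R :: real
    have "compact (\<Phi> ` cball 0 R)"
      by (intro compact_continuous_image continuous_on_subset[OF cont]) auto
    then obtain C where C: "\<And>w. w \<in> cball 0 R \<Longrightarrow> norm (\<Phi> w) \<le> C"
      using compact_imp_bounded bounded_iff by (metis imageI)
    \<comment> \<open>The vertical shift is unbounded in \<open>v\<close>, but \<open>ridge\<close>
      replaces the argument by \<open>Re z\<close>, which stays in the disc where \<open>C\<close>
      bounds \<open>\<Phi>\<close>.\<close>
    have "norm (\<Phi> (z + \<i> * of_real (\<delta> * v))) \<le> C" if "norm z \<le> R" for z :: complex and v :: real
    proof -
      have "norm (\<Phi> (z + \<i> * of_real (\<delta> * v))) \<le> norm (\<Phi> (of_real (Re z)))"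
        using ridge[of "z + \<i> * of_real (\<delta> * v)"] by simp
      also have "\<dots> \<le> C" using abs_Re_le_cmod[of z] that by (intro C) simp
      finally show ?thesis .
    qed
    then show "\<exists>g::real \<Rightarrow> real. integrable std_normal_distribution g \<and>
        (AE v in std_normal_distribution. \<forall>z. norm z \<le> R \<longrightarrow> norm (\<Phi> (z + \<i> * of_real (\<delta> * v))) \<le> g v)"
      by (intro exI[of _ "\<lambda>_. C"]) auto
  next
    fix z
    show "(\<lambda>v. \<Phi> (z + \<i> * of_real (\<delta> * v))) \<in> borel_measurable std_normal_distribution"
      by (simp, intro borel_measurable_continuous_onI continuous_intros
          continuous_on_compose2[OF cont]) auto
  next
    fix v
    have "\<Phi> \<circ> (\<lambda>z. z + \<i> * of_real (\<delta> * v)) holomorphic_on UNIV"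
      by (rule holomorphic_on_compose_gen[OF _ entire]) (auto intro!: holomorphic_intros)
    then show "(\<lambda>z. \<Phi> (z + \<i> * of_real (\<delta> * v))) holomorphic_on UNIV"
      by (simp add: comp_def)
  qed
  fix s :: real
  have "?A (\<i> * of_real s) = (LINT x|M. iexp (s * x) * char std_normal_distribution (\<delta> * x))"
  proof (intro Bochner_Integration.integral_cong refl)
    fix x
    have "exp (\<i> * of_real s * of_real x - of_real (\<delta>\<^sup>2 * x\<^sup>2 / 2)) =
        exp (\<i> * of_real (s * x) + of_real (- (\<delta> * x)\<^sup>2 / 2))"
      by (simp add: power_mult_distrib algebra_simps)
    then show "exp (\<i> * of_real s * of_real x - of_real (\<delta>\<^sup>2 * x\<^sup>2 / 2)) =
        iexp (s * x) * char std_normal_distribution (\<delta> * x)"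
      unfolding char_std_normal_distribution exp_add exp_of_real .
  qed
  also have "\<dots> = (LINT x|M. LINT v|std_normal_distribution. iexp ((s + \<delta> * v) * x))"
    unfolding char_def
    by (intro Bochner_Integration.integral_cong refl, subst integral_mult_right_zero[symmetric])
       (intro Bochner_Integration.integral_cong refl, simp add: exp_add[symmetric] algebra_simps)
  also have "\<dots> = (LINT v|std_normal_distribution. LINT x|M. iexp ((s + \<delta> * v) * x))"
  proof (rule MN.Fubini_integral[symmetric])
    have "(\<lambda>p. iexp ((s + \<delta> * snd p) * fst p)) \<in> borel_measurable (borel \<Otimes>\<^sub>M borel)"
      by measurable
    then have "(\<lambda>(x, v). iexp ((s + \<delta> * v) * x)) \<in> borel_measurable (M \<Otimes>\<^sub>M std_normal_distribution)"
      by (simp add: case_prod_beta' cong: measurable_cong_sets sets_pair_measure_cong)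
    then show "integrable (M \<Otimes>\<^sub>M std_normal_distribution) (\<lambda>(x, v). iexp ((s + \<delta> * v) * x))"
      by (intro MN.integrable_const_bound[where B = 1]) auto
  qed
  also have "\<dots> = ?B (\<i> * of_real s)"
    unfolding char_def[symmetric] char_eq by (simp add: distrib_left)
  finally show "?A (\<i> * of_real s) = ?B (\<i> * of_real s)" .
qed

text \<open>As the damping parameter tends to 0, the Gaussian average of \<open>\<Phi>\<close>
  concentrates at \<open>z\<close> by continuity. By \<open>ridge\<close> the constant
  \<open>norm (\<Phi> (of_real (Re z)))\<close> dominates.\<close>

lemma gaussian_damped_mgf_tendsto:
  "(\<lambda>n. LINT x|M. exp (z * of_real x - of_real ((1 / real (Suc n))\<^sup>2 * x\<^sup>2 / 2))) \<longlonglongrightarrow> \<Phi> z"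
proof -
  interpret N: real_distribution std_normal_distribution
    by (rule real_dist_normal_dist)
  have cont: "continuous_on UNIV \<Phi>"
    using entire by (rule holomorphic_on_imp_continuous_on)
  let ?d = "\<lambda>n. 1 / real (Suc n)"
  have "(\<lambda>n. LINT v|std_normal_distribution. \<Phi> (z + \<i> * of_real (?d n * v)))
      \<longlonglongrightarrow> (LINT v|std_normal_distribution. \<Phi> z)"
  proof (rule integral_dominated_convergence)
    have "(\<lambda>v. \<Phi> (z + \<i> * of_real (d * v))) \<in> borel_measurable borel" for d
      by (intro borel_measurable_continuous_onI continuous_intros
          continuous_on_compose2[OF cont]) auto
    from this[of "?d n" for n]
    show "(\<lambda>v. \<Phi> (z + \<i> * of_real (?d n * v))) \<in> borel_measurable std_normal_distribution" for n
      by simp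
    show "AE v in std_normal_distribution. (\<lambda>n. \<Phi> (z + \<i> * of_real (?d n * v))) \<longlonglongrightarrow> \<Phi> z"
    proof (rule AE_I2)
      fix v
      have "(\<lambda>n. ?d n * v) \<longlonglongrightarrow> 0 * v"
        by (intro tendsto_mult tendsto_const LIMSEQ_Suc[OF lim_1_over_n])
      then have "(\<lambda>n. z + \<i> * of_real (?d n * v)) \<longlonglongrightarrow> z + \<i> * of_real (0 * v)"
        by (rule tendsto_add[OF tendsto_const tendsto_mult[OF tendsto_const tendsto_of_real]])
      then have "(\<lambda>n. \<Phi> (z + \<i> * of_real (?d n * v))) \<longlonglongrightarrow> \<Phi> (z + \<i> * of_real (0 * v))"
        using cont by (intro isCont_tendsto_compose[where g = \<Phi>])
          (auto simp: continuous_on_eq_continuous_at)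
      then show "(\<lambda>n. \<Phi> (z + \<i> * of_real (?d n * v))) \<longlonglongrightarrow> \<Phi> z" by simp
    qed
    show "AE v in std_normal_distribution. norm (\<Phi> (z + \<i> * of_real (?d n * v))) \<le> norm (\<Phi> (of_real (Re z)))" for n
      using ridge[of "z + \<i> * of_real (?d n * v)" for v] by (intro AE_I2) simp
  qed auto
  moreover have "?d n \<noteq> 0" for n by simp
  note gaussian_damped_mgf[OF this, of z]
  moreover have "(LINT v|std_normal_distribution. \<Phi> z) = \<Phi> z"
    using N.prob_space by simp
  ultimately show ?thesis by (simp only:)
qed

text \<open>For real \<open>r\<close> the damped integrands increase to \<open>exp (r * x)\<close>
  and their integrals converge to a finite limit, so monotone convergence gives integrability. For
  complex \<open>z\<close> the function \<open>exp (Re z * x)\<close> then dominates, and the limit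
  of the damped integrals is identified.\<close>

lemma integrable_exp_of_char_ridge: "integrable M (\<lambda>x. exp (r * x))"
  and integral_cexp_of_char_ridge: "(LINT x|M. exp (z * of_real x)) = \<Phi> z"
proof -
  let ?d = "\<lambda>n. 1 / real (Suc n)"
  have d0: "(\<lambda>n. (?d n)\<^sup>2 * x\<^sup>2 / 2) \<longlonglongrightarrow> 0" for x
  proof -
    have "(\<lambda>n. (?d n)\<^sup>2 * x\<^sup>2 / 2) \<longlonglongrightarrow> 0\<^sup>2 * x\<^sup>2 / 2"
      by (intro tendsto_intros LIMSEQ_Suc[OF lim_1_over_n]) auto
    then show ?thesis by simp
  qed
  have int: "integrable M (\<lambda>x. exp (r * x))" for r
  proof (rule integrable_monotone_convergence)
    let ?f = "\<lambda>n x. exp (r * x - (?d n)\<^sup>2 * x\<^sup>2 / 2)"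
    show "integrable M (?f n)" for n
    proof (rule integrable_const_bound)
      \<comment> \<open>Again by completing the square: each damped integrand is bounded.\<close>
      show "AE x in M. norm (?f n x) \<le> exp (r\<^sup>2 / (2 * (?d n)\<^sup>2))"
      proof (rule AE_I2)
        fix x
        have "0 \<le> (r / ?d n - ?d n * x)\<^sup>2" by simp
        also have "\<dots> = r\<^sup>2 / (?d n)\<^sup>2 + (?d n)\<^sup>2 * x\<^sup>2 - 2 * (r * x)"
          by (simp add: power2_diff power_divide power_mult_distrib)
        finally show "norm (?f n x) \<le> exp (r\<^sup>2 / (2 * (?d n)\<^sup>2))" by (simp add: field_simps)
      qed
    qed simp
    show "AE x in M. mono (\<lambda>n. ?f n x)"
    proof (rule AE_I2, rule monoI)
      fix x and m n :: nat assume "m \<le> n"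
      then have "(?d n)\<^sup>2 \<le> (?d m)\<^sup>2" by (intro power_mono frac_le) auto
      then show "?f m x \<le> ?f n x" by (simp add: mult_right_mono)
    qed
    show "AE x in M. (\<lambda>n. ?f n x) \<longlonglongrightarrow> exp (r * x)"
      using tendsto_exp[OF tendsto_diff[OF tendsto_const d0]] by (intro AE_I2) fastforce
    \<comment> \<open>Monotone convergence needs a real limit; it is the real part of the complex
      one at \<open>z = of_real r\<close>.\<close>
    have "(\<lambda>n. Re (LINT x|M. of_real (?f n x))) \<longlonglongrightarrow> Re (\<Phi> (of_real r))"
      using tendsto_Re[OF gaussian_damped_mgf_tendsto[of "of_real r"]]
      by (simp add: exp_of_real[symmetric] del: exp_of_real)
    then show "(\<lambda>n. integral\<^sup>L M (?f n)) \<longlonglongrightarrow> Re (\<Phi> (of_real r))"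
      by (simp only: integral_complex_of_real Re_complex_of_real)
  qed simp
  show "integrable M (\<lambda>x. exp (r * x))" by (rule int)
  have "(\<lambda>n. LINT x|M. exp (z * of_real x - of_real ((?d n)\<^sup>2 * x\<^sup>2 / 2)))
      \<longlonglongrightarrow> (LINT x|M. exp (z * of_real x))"
  proof (rule integral_dominated_convergence)
    show "AE x in M. (\<lambda>n. exp (z * of_real x - of_real ((?d n)\<^sup>2 * x\<^sup>2 / 2))) \<longlonglongrightarrow> exp (z * of_real x)"
    proof (rule AE_I2)
      fix x
      have "(\<lambda>n. exp (z * of_real x - of_real ((?d n)\<^sup>2 * x\<^sup>2 / 2))) \<longlonglongrightarrow> exp (z * of_real x - of_real 0)"
        by (intro tendsto_exp tendsto_diff tendsto_const tendsto_of_real d0)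
      then show "(\<lambda>n. exp (z * of_real x - of_real ((?d n)\<^sup>2 * x\<^sup>2 / 2))) \<longlonglongrightarrow> exp (z * of_real x)"
        by simp
    qed
    show "AE x in M. norm (exp (z * of_real x - of_real ((?d n)\<^sup>2 * x\<^sup>2 / 2))) \<le> exp (Re z * x)" for n
      by (intro AE_I2) simp
  qed (use int in auto)
  then show "(LINT x|M. exp (z * of_real x)) = \<Phi> z"
    by (rule LIMSEQ_unique) (rule gaussian_damped_mgf_tendsto)
qed

end

end

subsection \<open>Independence under a product density\<close>

lemma (in prob_space) indep_sets_reindex:
  assumes inj: "inj_on f K" and indep: "indep_sets F (f ` K)"
  shows "indep_sets (\<lambda>k. F (f k)) K"
proof (rule indep_setsI)
  show "F (f k) \<subseteq> events" if "k \<in> K" for k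
    using indep that by (auto simp: indep_sets_def)
  fix A J assume J: "J \<noteq> {}" "J \<subseteq> K" "finite J" and A: "\<forall>j\<in>J. A j \<in> F (f j)"
  have injJ: "inj_on f J" using inj J by (blast intro: inj_on_subset)
  let ?B = "\<lambda>i. A (inv_into J f i)"
  have "prob (\<Inter>i\<in>f ` J. ?B i) = (\<Prod>i\<in>f ` J. prob (?B i))"
    using A J injJ by (intro indep_setsD[OF indep]) auto
  then show "prob (\<Inter>j\<in>J. A j) = (\<Prod>j\<in>J. prob (A j))"
    using injJ by (simp add: prod.reindex)
qed

lemma (in prob_space) indep_vars_reindex:
  assumes "inj_on f K" "indep_vars M' X (f ` K)"
  shows "indep_vars (\<lambda>k. M' (f k)) (\<lambda>k. X (f k)) K"
  using assms unfolding indep_vars_def2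
  by (auto intro: indep_sets_reindex[where F = "\<lambda>i. {X i -` A \<inter> space M |A. A \<in> sets (M' i)}"])

text \<open>Independence factorizes the integral of the product of all
  \<open>g i (D i \<omega>)\<close> over a set of the form "\<open>D j\<close> in \<open>A j\<close>
  for all \<open>j\<close>". Suitable choices of the sets \<open>A j\<close> in this one formula
  give the total mass, the marginal laws and the independence.\<close>

lemma (in prob_space) product_density:
  fixes D :: "'i \<Rightarrow> 'a \<Rightarrow> real" and g :: "'i \<Rightarrow> real \<Rightarrow> ennreal"
  assumes fin: "finite I" "I \<noteq> {}"
    and indep: "indep_vars (\<lambda>_. borel) D I"
    and g[measurable]: "\<And>i. i \<in> I \<Longrightarrow> g i \<in> borel_measurable borel"
    and norm: "\<And>i. i \<in> I \<Longrightarrow> (\<integral>\<^sup>+\<omega>. g i (D i \<omega>) \<partial>M) = 1"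
    and Q: "Q = density M (\<lambda>\<omega>. \<Prod>i\<in>I. g i (D i \<omega>))"
  shows prob_space_product_density: "prob_space Q"
    and indep_vars_product_density: "prob_space.indep_vars Q (\<lambda>_. borel) D I"
    and distr_product_density: "\<And>i. i \<in> I \<Longrightarrow> distr Q borel (D i) = density (distr M borel (D i)) (g i)"
proof -
  have D[measurable]: "D i \<in> borel_measurable M" if "i \<in> I" for i
    using indep that by (auto simp: indep_vars_def)
  have meas: "(\<lambda>\<omega>. \<Prod>i\<in>I. g i (D i \<omega>)) \<in> borel_measurable M"
    by (intro borel_measurable_prod_ennreal) auto
  have space: "space Q = space M" and sets: "sets Q = sets M" using Q by auto
  have emeas: "emeasure Q (\<Inter>j\<in>I. D j -` A j \<inter> space M) =
      (\<Prod>j\<in>I. \<integral>\<^sup>+\<omega>. g j (D j \<omega>) * indicator (A j) (D j \<omega>) \<partial>M)"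
    if A: "\<And>j. j \<in> I \<Longrightarrow> A j \<in> sets borel" for A
  proof -
    have "(\<Inter>j\<in>I. D j -` A j \<inter> space M) \<in> sets M"
      using fin A by (intro sets.finite_INT measurable_sets[OF D]) auto
    then have "emeasure Q (\<Inter>j\<in>I. D j -` A j \<inter> space M) =
        (\<integral>\<^sup>+\<omega>. (\<Prod>i\<in>I. g i (D i \<omega>)) * indicator (\<Inter>j\<in>I. D j -` A j \<inter> space M) \<omega> \<partial>M)"
      unfolding Q by (rule emeasure_density[OF meas])
    also have "\<dots> = (\<integral>\<^sup>+\<omega>. (\<Prod>i\<in>I. g i (D i \<omega>) * indicator (A i) (D i \<omega>)) \<partial>M)"
    proof (rule nn_integral_cong)
      fix \<omega> assume "\<omega> \<in> space M"
      then have "indicator (\<Inter>j\<in>I. D j -` A j \<inter> space M) \<omega> = (\<Prod>i\<in>I. indicator (A i) (D i \<omega>) :: ennreal)"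
        using fin by (auto simp: indicator_def)
      then show "(\<Prod>i\<in>I. g i (D i \<omega>)) * indicator (\<Inter>j\<in>I. D j -` A j \<inter> space M) \<omega> =
          (\<Prod>i\<in>I. g i (D i \<omega>) * indicator (A i) (D i \<omega>))"
        by (simp add: prod.distrib)
    qed
    also have "\<dots> = (\<Prod>j\<in>I. \<integral>\<^sup>+\<omega>. g j (D j \<omega>) * indicator (A j) (D j \<omega>) \<partial>M)"
    proof (rule indep_vars_nn_integral[OF fin(1)])
      show "indep_vars (\<lambda>_. borel) (\<lambda>i \<omega>. g i (D i \<omega>) * indicator (A i) (D i \<omega>)) I"
        using A by (intro indep_vars_compose2[OF indep, where Y = "\<lambda>i x. g i x * indicator (A i) x"])
          (auto intro!: borel_measurable_times_ennreal borel_measurable_indicator)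
    qed simp
    finally show ?thesis .
  qed
  have one: "emeasure Q (D i -` B \<inter> space M) = (\<integral>\<^sup>+\<omega>. g i (D i \<omega>) * indicator B (D i \<omega>) \<partial>M)"
    if i: "i \<in> I" and B: "B \<in> sets borel" for i B
  proof -
    \<comment> \<open>Every factor with \<open>j \<noteq> i\<close> is then a full integral, equal
      to 1 by \<open>norm\<close>.\<close>
    let ?A = "\<lambda>j. if j = i then B else UNIV"
    have "(\<Inter>j\<in>I. D j -` ?A j \<inter> space M) = D i -` B \<inter> space M"
      using i by (auto split: if_splits)
    then have "emeasure Q (D i -` B \<inter> space M) =
        (\<Prod>j\<in>I. \<integral>\<^sup>+\<omega>. g j (D j \<omega>) * indicator (?A j) (D j \<omega>) \<partial>M)"
      using emeas[of ?A] B by simp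
    also have "\<dots> = (\<Prod>j\<in>I. if j = i then \<integral>\<^sup>+\<omega>. g j (D j \<omega>) * indicator B (D j \<omega>) \<partial>M else 1)"
      by (rule prod.cong) (auto simp: norm)
    finally show ?thesis using i fin by simp
  qed
  show "prob_space Q"
  proof
    obtain i where i: "i \<in> I" using fin by auto
    show "emeasure Q (space Q) = 1"
      using one[OF i, of UNIV] norm[OF i] by (simp add: space)
  qed
  then interpret Q: prob_space Q .
  have QD: "D i \<in> borel_measurable Q" if "i \<in> I" for i
    using D[OF that] by (simp add: measurable_def space sets)
  show "distr Q borel (D i) = density (distr M borel (D i)) (g i)" if i: "i \<in> I" for i
  proof (rule measure_eqI)
    fix B assume "B \<in> sets (distr Q borel (D i))"
    then have B[measurable]: "B \<in> sets borel" by simp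
    have [measurable]: "D i \<in> borel_measurable M" "g i \<in> borel_measurable borel"
      using i D g by auto
    have "emeasure (density (distr M borel (D i)) (g i)) B =
        (\<integral>\<^sup>+x. g i x * indicator B x \<partial>distr M borel (D i))"
      by (rule emeasure_density) auto
    also have "\<dots> = (\<integral>\<^sup>+\<omega>. g i (D i \<omega>) * indicator B (D i \<omega>) \<partial>M)"
      by (rule nn_integral_distr) measurable
    finally show "emeasure (distr Q borel (D i)) B = emeasure (density (distr M borel (D i)) (g i)) B"
      using one[OF i B] by (simp add: emeasure_distr[OF QD[OF i] B] space)
  qed simp
  show "Q.indep_vars (\<lambda>_. borel) D I"
  proof (subst Q.indep_vars_finite[where E = "\<lambda>_. sets borel"])
    show "\<forall>A\<in>(\<Pi> i\<in>I. sets borel). Q.prob (\<Inter>j\<in>I. D j -` A j \<inter> space Q) =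
        (\<Prod>j\<in>I. Q.prob (D j -` A j \<inter> space Q))"
    proof
      fix A :: "'i \<Rightarrow> real set" assume "A \<in> (\<Pi> i\<in>I. sets borel)"
      then have A: "A j \<in> sets borel" if "j \<in> I" for j using that by auto
      have "ennreal (Q.prob (\<Inter>j\<in>I. D j -` A j \<inter> space M)) =
          (\<Prod>j\<in>I. emeasure Q (D j -` A j \<inter> space M))"
        using emeas[OF A] one A by (simp add: Q.emeasure_eq_measure[symmetric])
      also have "\<dots> = ennreal (\<Prod>j\<in>I. Q.prob (D j -` A j \<inter> space M))"
        by (simp add: Q.emeasure_eq_measure prod_ennreal)
      finally show "Q.prob (\<Inter>j\<in>I. D j -` A j \<inter> space Q) = (\<Prod>j\<in>I. Q.prob (D j -` A j \<inter> space Q))"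
        by (simp add: space prod_nonneg)
    qed
  qed (use fin QD in \<open>auto simp: Int_stable_def sets.sigma_sets_eq[of borel, simplified]\<close>)
qed

subsection \<open>Cadlag paths and supports of measures\<close>

text \<open>Boundedness passes to unions of adjacent intervals, so it suffices to have it on short
  intervals around each point. There the one-sided limits bound the path on either side of the
  point.\<close>

lemma bounded_cadlag_on_unit_interval:
  assumes "cadlag_on_unit_interval f"
  shows "bounded (f ` {0..1})"
proof -
  have "bounded (f ` ({0..1} \<inter> {0..1}))"
  \<comment> \<open>The intersection with \<open>{0..1}\<close> lets short intervals around an
    endpoint protrude from the unit interval, where nothing is known about \<open>f\<close>.\<close>
  proof (rule Bolzano[where P = "\<lambda>a b. bounded (f ` ({a..b} \<inter> {0..1}))"])
    fix a b c :: real assume "bounded (f ` ({a..b} \<inter> {0..1}))" "bounded (f ` ({b..c} \<inter> {0..1}))"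
      and "a \<le> b" "b \<le> c"
    then have "bounded (f ` ({a..b} \<inter> {0..1}) \<union> f ` ({b..c} \<inter> {0..1}))"
      unfolding bounded_Un by simp
    moreover have "f ` ({a..c} \<inter> {0..1}) \<subseteq> f ` ({a..b} \<inter> {0..1}) \<union> f ` ({b..c} \<inter> {0..1})"
      unfolding image_Un[symmetric] by (rule image_mono) auto
    ultimately show "bounded (f ` ({a..c} \<inter> {0..1}))" by (rule bounded_subset)
  next
    fix x :: real assume x: "0 \<le> x" "x \<le> 1"
    have local_bound: "\<exists>d>0. \<exists>B. \<forall>y. y \<in> S \<longrightarrow> dist y x < d \<longrightarrow> y \<noteq> x \<longrightarrow> norm (f y) \<le> B"
      if "(f \<longlongrightarrow> l) (at x within S)" for S l
    proof -
      have "eventually (\<lambda>y. dist (f y) l < 1) (at x within S)"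
        using that by (rule tendstoD) simp
      then obtain d where "d > 0" and d: "\<And>y. y \<in> S \<Longrightarrow> y \<noteq> x \<Longrightarrow> dist y x < d \<Longrightarrow> dist (f y) l < 1"
        unfolding eventually_at by blast
      have "norm (f y) \<le> norm l + 1" if "dist (f y) l < 1" for y
        using that by (simp add: dist_real_def)
      then show ?thesis using \<open>d > 0\<close> d by blast
    qed
    have right: "\<exists>d>0. \<exists>B. \<forall>y. y \<in> {x<..} \<inter> {0..1} \<longrightarrow> dist y x < d \<longrightarrow> y \<noteq> x \<longrightarrow> norm (f y) \<le> B"
    proof (cases "x = 1")
      case True then show ?thesis by (intro exI[of _ 1]) auto
    next
      case False
      then have "(f \<longlongrightarrow> f x) (at x within {x<..})"
        using assms x by (auto simp: cadlag_on_unit_interval_def)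
      from local_bound[OF this] show ?thesis by blast
    qed
    have left: "\<exists>d>0. \<exists>B. \<forall>y. y \<in> {..<x} \<inter> {0..1} \<longrightarrow> dist y x < d \<longrightarrow> y \<noteq> x \<longrightarrow> norm (f y) \<le> B"
    proof (cases "x = 0")
      case True then show ?thesis by (intro exI[of _ 1]) auto
    next
      case False
      then obtain l where "(f \<longlongrightarrow> l) (at x within {..<x})"
        using assms x by (force simp: cadlag_on_unit_interval_def)
      from local_bound[OF this] show ?thesis by blast
    qed
    obtain d1 B1 where 1: "d1 > 0"
      "\<And>y. y \<in> {x<..} \<inter> {0..1} \<Longrightarrow> dist y x < d1 \<Longrightarrow> norm (f y) \<le> B1"
      using right by fastforce
    obtain d2 B2 where 2: "d2 > 0"
      "\<And>y. y \<in> {..<x} \<inter> {0..1} \<Longrightarrow> dist y x < d2 \<Longrightarrow> norm (f y) \<le> B2"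
      using left by fastforce
    show "\<exists>d>0. \<forall>a b. a \<le> x \<and> x \<le> b \<and> b - a < d \<longrightarrow> bounded (f ` ({a..b} \<inter> {0..1}))"
    proof (intro exI[of _ "min d1 d2"] conjI allI impI)
      fix a b assume ab: "a \<le> x \<and> x \<le> b \<and> b - a < min d1 d2"
      show "bounded (f ` ({a..b} \<inter> {0..1}))"
      proof (rule boundedI)
        fix z assume "z \<in> f ` ({a..b} \<inter> {0..1})"
        then obtain y where y: "z = f y" "y \<in> {a..b}" "y \<in> {0..1}" by auto
        consider "y = x" | "y < x" | "y > x" by linarith
        \<comment> \<open>The value at \<open>x\<close> enters separately, because the one-sided
          bounds leave out the point itself.\<close>
        then show "norm z \<le> max (norm (f x)) (max B1 B2)"
        proof cases
          case 2
          then have "norm (f y) \<le> B2" using y ab by (intro \<open>\<And>y. y \<in> {..<x} \<inter> {0..1} \<Longrightarrow> dist y x < d2 \<Longrightarrow> norm (f y) \<le> B2\<close>) (auto simp: dist_real_def)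
          then show ?thesis using y by simp
        next
          case 3
          then have "norm (f y) \<le> B1" using y ab by (intro 1(2)) (auto simp: dist_real_def)
          then show ?thesis using y by simp
        qed (use y in simp)
      qed
    qed (use 1 2 in simp)
  qed simp
  then show ?thesis by simp
qed

text \<open>Boundedness of the path is what makes the real-valued \<open>SUP\<close> an upper
  bound.\<close>

lemma abs_le_sup_norm:
  assumes "cadlag_on_unit_interval (\<lambda>t. X t \<omega>)" "t \<in> {0..1}"
  shows "\<bar>X t \<omega>\<bar> \<le> sup_norm X \<omega>"
proof -
  obtain B where "\<forall>t\<in>{0..1}. \<bar>X t \<omega>\<bar> \<le> B"
    using bounded_cadlag_on_unit_interval[OF assms(1)] by (auto simp: bounded_iff)
  then show ?thesis
    unfolding sup_norm_def using assms(2) by (intro cSUP_upper bdd_aboveI2[where M = B]) auto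
qed

text \<open>Every point outside the support has an open null neighbourhood. By Lindelof, countably
  many open null sets cover the union of all of them, which is therefore null.\<close>

lemma AE_in_of_measure_support_subset:
  assumes sets: "sets \<nu> = sets borel" and "measure_support \<nu> \<subseteq> S"
  shows "AE x in \<nu>. x \<in> S"
proof -
  obtain \<F> where \<F>: "\<F> \<subseteq> {U. open U \<and> emeasure \<nu> U = 0}" "countable \<F>"
    "\<Union>\<F> = \<Union>{U. open U \<and> emeasure \<nu> U = 0}"
    using Lindelof[of "{U::real set. open U \<and> emeasure \<nu> U = 0}"] by auto
  have "\<Union>\<F> \<in> null_sets \<nu>"
  proof -
    have "U \<in> null_sets \<nu>" if "U \<in> \<F>" for U
      using \<F>(1) that sets by (auto simp: null_sets_def)
    then show ?thesis using null_sets_UN'[of \<F> id \<nu>] \<F>(2) by simp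
  qed
  moreover have "{x \<in> space \<nu>. x \<notin> S} \<subseteq> \<Union>\<F>"
  proof
    fix x assume "x \<in> {x \<in> space \<nu>. x \<notin> S}"
    then have "x \<notin> measure_support \<nu>" using assms(2) by auto
    then obtain U where "open U" "x \<in> U" "emeasure \<nu> U = 0"
      unfolding measure_support_def by (auto simp: zero_less_iff_neq_zero)
    then show "x \<in> \<Union>\<F>" unfolding \<F>(3) by blast
  qed
  ultimately show ?thesis by (rule AE_I')
qed

subsection \<open>Levy processes with bounded jumps\<close>

text \<open>Second-order Taylor remainder of \<open>exp\<close>. The quadratic factor makes it
  integrable against a Levy measure on the unit ball, uniformly for \<open>z\<close> in a
  disc.\<close>

lemma norm_exp_remainder_le:
  assumes "\<bar>x\<bar> \<le> 1" "norm z \<le> R"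
  shows "norm (exp (z * complex_of_real x) - 1 - z * complex_of_real x) \<le> exp R * R\<^sup>2 * x\<^sup>2"
proof -
  have zx: "norm (z * complex_of_real x) \<le> R * \<bar>x\<bar>"
    using assms(2) by (simp add: norm_mult mult_right_mono)
  have R: "0 \<le> R" using assms(2) norm_ge_zero[of z] by linarith
  have "norm (exp (z * complex_of_real x) - 1 - z * complex_of_real x)
      \<le> exp \<bar>Re (z * complex_of_real x)\<bar> * (norm (z * complex_of_real x))\<^sup>2"
    using Taylor_exp[of "z * complex_of_real x" 1] by (simp add: diff_diff_eq power2_eq_square)
  also have "\<dots> \<le> exp R * (R * \<bar>x\<bar>)\<^sup>2"
  proof (intro mult_mono power_mono)
    have "\<bar>Re (z * complex_of_real x)\<bar> \<le> R * \<bar>x\<bar>"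
      using abs_Re_le_cmod[of "z * complex_of_real x"] zx by linarith
    also have "\<dots> \<le> R * 1" using assms R by (intro mult_left_mono) auto
    finally show "exp \<bar>Re (z * complex_of_real x)\<bar> \<le> exp R" by simp
  qed (use zx in auto)
  finally show ?thesis by (simp add: power_mult_distrib mult.assoc)
qed

text \<open>The support condition appears here in almost-everywhere form, ready for use under
  integrals.\<close>

locale levy_process_bounded_jumps = levy_process_with_triplet +
  assumes bounded_jumps: "AE x in \<nu>. \<bar>x\<bar> \<le> 1"
begin

lemma sets_levy_measure [measurable_cong, simp]: "sets \<nu> = sets borel"
  using levy_measure(1) by (simp add: measure_off_zero_def)

lemma integrable_square: "integrable \<nu> (\<lambda>x. x\<^sup>2)"
proof (rule integrableI_bounded)
  have "(\<integral>\<^sup>+x. ennreal (norm (x\<^sup>2)) \<partial>\<nu>) = (\<integral>\<^sup>+x. ennreal (min 1 (x\<^sup>2)) \<partial>\<nu>)"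
    using bounded_jumps
    by (intro nn_integral_cong_AE) (auto elim!: eventually_mono simp: abs_square_le_1 min_absorb2)
  then show "(\<integral>\<^sup>+x. ennreal (norm (x\<^sup>2)) \<partial>\<nu>) < \<infinity>"
    using levy_measure(2) by simp
qed simp

lemma exp_remainder_bound:
  "\<exists>g::real \<Rightarrow> real. integrable \<nu> g \<and> (AE x in \<nu>. \<forall>z. norm z \<le> R \<longrightarrow>
     norm (exp (z * complex_of_real x) - 1 - z * complex_of_real x) \<le> g x)"
proof (intro exI[of _ "\<lambda>x. exp R * R\<^sup>2 * x\<^sup>2"] conjI)
  show "AE x in \<nu>. \<forall>z. norm z \<le> R \<longrightarrow>
      norm (exp (z * complex_of_real x) - 1 - z * complex_of_real x) \<le> exp R * R\<^sup>2 * x\<^sup>2"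
    using bounded_jumps by eventually_elim (use norm_exp_remainder_le in auto)
qed (use integrable_square in simp)

lemma exp_remainder_measurable:
  "(\<lambda>x. exp (z * complex_of_real x) - 1 - z * complex_of_real x) \<in> borel_measurable \<nu>"
  by measurable

lemma integrable_exp_remainder:
  "integrable \<nu> (\<lambda>x. exp (z * complex_of_real x) - 1 - z * complex_of_real x)"
proof -
  obtain g :: "real \<Rightarrow> real" where "integrable \<nu> g" and
    "AE x in \<nu>. \<forall>w. norm w \<le> norm z \<longrightarrow>
       norm (exp (w * complex_of_real x) - 1 - w * complex_of_real x) \<le> g x"
    using exp_remainder_bound by blast
  then show ?thesis
    by (intro Bochner_Integration.integrable_bound[OF _ exp_remainder_measurable])
      (auto elim!: eventually_mono intro: order_trans[OF _ abs_ge_self])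
qed

section \<open>The cumulant function on the complex plane\<close>

definition \<Lambda> :: "complex \<Rightarrow> complex" where
  "\<Lambda> z = of_real (\<sigma>2 / 2) * z\<^sup>2 + of_real b * z +
     (LINT x|\<nu>. exp (z * complex_of_real x) - 1 - z * complex_of_real x)"

lemma has_field_derivative_\<Lambda>:
  "(\<Lambda> has_field_derivative
     of_real \<sigma>2 * z + of_real b + (LINT x|\<nu>. of_real x * (exp (z * complex_of_real x) - 1))) (at z)"
proof -
  have d: "((\<lambda>z. exp (z * complex_of_real x) - 1 - z * complex_of_real x) has_field_derivative
      of_real x * (exp (z * complex_of_real x) - 1)) (at z)" for x z
    by (auto intro!: derivative_eq_intros simp: algebra_simps)
  have "((\<lambda>z. LINT x|\<nu>. exp (z * complex_of_real x) - 1 - z * complex_of_real x) has_field_derivative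
      (LINT x|\<nu>. of_real x * (exp (z * complex_of_real x) - 1))) (at z)"
    \<comment> \<open>This writes the integrand as a \<open>deriv\<close>, the form in which
      differentiation under the integral sign delivers it.\<close>
    unfolding DERIV_imp_deriv[OF d, symmetric]
    by (rule has_field_derivative_lebesgue_integral[OF exp_remainder_measurable _ exp_remainder_bound])
      (intro holomorphic_intros)
  then show ?thesis
    unfolding \<Lambda>_def[abs_def] by (auto intro!: derivative_eq_intros)
qed

lemma \<Lambda>_of_real: "\<Lambda> (of_real r) = of_real (levy_log_mgf \<nu> \<sigma>2 b r)"
proof -
  have "(LINT x|\<nu>. exp (of_real r * complex_of_real x) - 1 - of_real r * complex_of_real x) =
      (LINT x|\<nu>. complex_of_real (exp (r * x) - 1 - r * x))"
    by (intro Bochner_Integration.integral_cong refl)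
       (simp add: exp_of_real[symmetric] del: exp_of_real)
  also have "\<dots> = of_real (LINT x|\<nu>. exp (r * x) - 1 - r * x)"
    by (rule integral_complex_of_real)
  finally show ?thesis by (simp add: \<Lambda>_def levy_log_mgf_def)
qed

text \<open>Since \<open>\<nu>\<close> charges only jumps of size at most 1, the indicator in
  \<open>levy_exponent\<close> is 1 almost everywhere and the truncated compensator is the full
  linear one.\<close>

lemma \<Lambda>_imaginary: "\<Lambda> (\<i> * of_real v) = - levy_exponent \<nu> \<sigma>2 b v"
proof -
  have "(LINT x|\<nu>. 1 - iexp (v * x) + indicator {x. \<bar>x\<bar> \<le> 1} x * (\<i> * of_real (v * x))) =
      (LINT x|\<nu>. - (exp (\<i> * of_real v * complex_of_real x) - 1 - \<i> * of_real v * complex_of_real x))"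
  proof (rule integral_cong_AE)
    show "AE x in \<nu>. 1 - iexp (v * x) + indicator {x. \<bar>x\<bar> \<le> 1} x * (\<i> * of_real (v * x)) =
        - (exp (\<i> * of_real v * complex_of_real x) - 1 - \<i> * of_real v * complex_of_real x)"
      using bounded_jumps by eventually_elim (simp add: algebra_simps)
  qed measurable
  also have "\<dots> = - (LINT x|\<nu>. exp (\<i> * of_real v * complex_of_real x) - 1 - \<i> * of_real v * complex_of_real x)"
    by (rule Bochner_Integration.integral_minus)
  finally show ?thesis
    by (simp add: \<Lambda>_def levy_exponent_def power_mult_distrib algebra_simps)
qed

text \<open>Under the integral, \<open>Re (exp w) \<le> norm (exp w) = exp (Re w)\<close>. In the
  Gaussian term the square of the imaginary part is subtracted, and the linear terms agree.\<close>

lemma Re_\<Lambda>_le: "Re (\<Lambda> z) \<le> levy_log_mgf \<nu> \<sigma>2 b (Re z)"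
proof -
  have "Re (LINT x|\<nu>. exp (z * complex_of_real x) - 1 - z * complex_of_real x) =
      (LINT x|\<nu>. Re (exp (z * complex_of_real x) - 1 - z * complex_of_real x))"
    by (rule integral_Re[symmetric, OF integrable_exp_remainder])
  also have "\<dots> \<le> (LINT x|\<nu>. exp (Re z * x) - 1 - Re z * x)"
  proof (rule integral_mono)
    show "integrable \<nu> (\<lambda>x. Re (exp (z * complex_of_real x) - 1 - z * complex_of_real x))"
      by (rule integrable_Re[OF integrable_exp_remainder])
    have "integrable \<nu> (\<lambda>x. Re (exp (of_real (Re z) * complex_of_real x) - 1 - of_real (Re z) * complex_of_real x))"
      by (rule integrable_Re[OF integrable_exp_remainder])
    then show "integrable \<nu> (\<lambda>x. exp (Re z * x) - 1 - Re z * x)"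
      by (simp add: Re_exp)
    show "Re (exp (z * complex_of_real x) - 1 - z * complex_of_real x) \<le> exp (Re z * x) - 1 - Re z * x" for x
      using complex_Re_le_cmod[of "exp (z * complex_of_real x)"] by simp
  qed
  moreover have "\<sigma>2 / 2 * Re (z\<^sup>2) \<le> \<sigma>2 / 2 * (Re z)\<^sup>2"
    using variance_nonneg by (intro mult_left_mono) (simp_all add: Re_power2)
  ultimately show ?thesis by (simp add: \<Lambda>_def levy_log_mgf_def)
qed

text \<open>Gaussian damping applied to the law of \<open>X t\<close>, with
  \<open>exp (of_real t * \<Lambda> z)\<close> as the entire extension of its characteristic
  function. The ridge condition is \<open>Re_\<Lambda>_le\<close> multiplied by
  \<open>t \<ge> 0\<close>.\<close>

lemma
  assumes t: "t \<in> {0..1}"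
  shows integrable_exp_levy: "integrable (distr M borel (X t)) (\<lambda>x. exp (r * x))"
    and integral_cexp_levy: "(LINT x|distr M borel (X t). exp (z * of_real x)) = exp (of_real t * \<Lambda> z)"
    and integral_exp_levy: "(LINT x|distr M borel (X t). exp (r * x)) = exp (t * levy_log_mgf \<nu> \<sigma>2 b r)"
proof -
  interpret D: real_distribution "distr M borel (X t)"
    using random_variables[OF t] by (rule real_distribution_distr)
  have hol: "(\<lambda>z. exp (of_real t * \<Lambda> z)) holomorphic_on UNIV"
    using has_field_derivative_\<Lambda>
    by (intro holomorphic_intros) (auto simp: holomorphic_on_open)
  have ridge: "norm (exp (of_real t * \<Lambda> z)) \<le> norm (exp (of_real t * \<Lambda> (of_real (Re z))))" for z
    using t Re_\<Lambda>_le[of z] by (simp add: \<Lambda>_of_real mult_left_mono)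
  have char: "char (distr M borel (X t)) v = exp (of_real t * \<Lambda> (\<i> * of_real v))" for v
    by (simp add: char_function[OF t] \<Lambda>_imaginary)
  note * = D.integrable_exp_of_char_ridge[OF hol ridge char]
    D.integral_cexp_of_char_ridge[OF hol ridge char]
  show "integrable (distr M borel (X t)) (\<lambda>x. exp (r * x))"
    "(LINT x|distr M borel (X t). exp (z * of_real x)) = exp (of_real t * \<Lambda> z)"
    by (rule *)+
  have "complex_of_real (LINT x|distr M borel (X t). exp (r * x)) =
      (LINT x|distr M borel (X t). exp (of_real r * of_real x))"
    by (simp add: integral_complex_of_real[symmetric] exp_of_real[symmetric] del: exp_of_real integral_complex_of_real)
  also have "\<dots> = of_real (exp (t * levy_log_mgf \<nu> \<sigma>2 b r))"
    by (simp add: *(2) \<Lambda>_of_real exp_of_real[symmetric] del: exp_of_real)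
  finally show "(LINT x|distr M borel (X t). exp (r * x)) = exp (t * levy_log_mgf \<nu> \<sigma>2 b r)"
    by (simp only: of_real_eq_iff)
qed

section \<open>The Esscher measure and its increments\<close>

definition L :: "real \<Rightarrow> real" where "L = levy_log_mgf \<nu> \<sigma>2 b"

definition esscher :: "real \<Rightarrow> 'a measure" where
  "esscher r = density M (\<lambda>\<omega>. ennreal (exp (r * X 1 \<omega> - L r)))"

lemma space_esscher [simp]: "space (esscher r) = space M"
  and sets_esscher [simp]: "sets (esscher r) = sets M"
  by (simp_all add: esscher_def)

text \<open>The constant \<open>c\<close> is left free for two uses: \<open>c = t * L r\<close>
  normalizes the density of an increment, and \<open>c = 2 * L r\<close> with \<open>2 * r\<close>
  for \<open>r\<close> gives the second moment of the Esscher density.\<close>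

lemma nn_integral_exp_levy:
  assumes "t \<in> {0..1}"
  shows "(\<integral>\<^sup>+x. ennreal (exp (r * x - c)) \<partial>distr M borel (X t)) = ennreal (exp (t * L r - c))"
proof -
  have "integrable (distr M borel (X t)) (\<lambda>x. exp (r * x) / exp c)"
    using integrable_exp_levy[OF assms] by (rule integrable_divide)
  then have "(\<integral>\<^sup>+x. ennreal (exp (r * x) / exp c) \<partial>distr M borel (X t)) =
      ennreal (LINT x|distr M borel (X t). exp (r * x) / exp c)"
    by (rule nn_integral_eq_integral) simp
  then show ?thesis
    by (simp add: exp_diff integral_exp_levy[OF assms] L_def)
qed

lemma distr_increment:
  assumes "0 \<le> s" "s \<le> t" "t \<le> 1"
  shows "distr M borel (\<lambda>\<omega>. X t \<omega> - X s \<omega>) = distr M borel (X (t - s))"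
proof -
  have "distr M borel (\<lambda>\<omega>. X (s + (t - s)) \<omega> - X s \<omega>) = distr M borel (\<lambda>\<omega>. X (t - s) \<omega> - X 0 \<omega>)"
    using assms by (intro stationary_increments) auto
  also have "\<dots> = distr M borel (X (t - s))"
    by (intro distr_cong) (auto simp: start_zero)
  finally show ?thesis by simp
qed

text \<open>Along a partition of \<open>[0,1]\<close> the Esscher density telescopes into a product of one factor per
  increment, so tilting changes the law of each increment separately.\<close>

lemma
  fixes s :: "nat \<Rightarrow> real"
  assumes m: "0 < m" and s0: "s 0 = 0" and sm: "s m = 1"
    and mono: "\<And>i. i < m \<Longrightarrow> s i \<le> s (Suc i)"
  defines "D \<equiv> \<lambda>i \<omega>. X (s (Suc i)) \<omega> - X (s i) \<omega>"
  shows prob_space_esscher_partition: "prob_space (esscher r)"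
    and indep_vars_esscher_partition: "prob_space.indep_vars (esscher r) (\<lambda>_. borel) D {..<m}"
    and distr_esscher_partition: "\<And>i. i < m \<Longrightarrow> distr (esscher r) borel (D i) =
          density (distr M borel (X (s (Suc i) - s i))) (\<lambda>x. ennreal (exp (r * x - (s (Suc i) - s i) * L r)))"
proof -
  have le: "s i \<le> s j" if "i \<le> j" "j \<le> m" for i j
    using that
  proof (induction j)
    case (Suc j)
    then show ?case using mono[of j] by (cases "i = Suc j") force+
  qed simp
  have s01: "0 \<le> s i" "s i \<le> 1" if "i \<le> m" for i
    using le[of 0 i] le[of i m] that s0 sm by auto
  let ?g = "\<lambda>i x. ennreal (exp (r * x - (s (Suc i) - s i) * L r))"
  have D: "distr M borel (D i) = distr M borel (X (s (Suc i) - s i))" if "i < m" for i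
    unfolding D_def using s01 mono[OF that] that by (intro distr_increment) auto
  have D_meas: "D i \<in> borel_measurable M" if "i < m" for i
    unfolding D_def using s01 that by (intro borel_measurable_diff random_variables) auto
  have indep: "indep_vars (\<lambda>_. borel) D {..<m}"
    unfolding D_def using s0 sm mono by (intro independent_increments) auto
  have norm: "(\<integral>\<^sup>+\<omega>. ?g i (D i \<omega>) \<partial>M) = 1" if "i < m" for i
  proof -
    have "(\<integral>\<^sup>+\<omega>. ?g i (D i \<omega>) \<partial>M) = (\<integral>\<^sup>+x. ?g i x \<partial>distr M borel (D i))"
      by (rule nn_integral_distr[OF D_meas[OF that], symmetric]) simp
    also have "\<dots> = 1"
      unfolding D[OF that] using s01[of i] s01[of "Suc i"] mono[OF that] that
      by (subst nn_integral_exp_levy) auto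
    finally show ?thesis .
  qed
  have Q: "esscher r = density M (\<lambda>\<omega>. \<Prod>i<m. ?g i (D i \<omega>))"
    unfolding esscher_def
  proof (rule density_cong)
    show "(\<lambda>\<omega>. ennreal (exp (r * X 1 \<omega> - L r))) \<in> borel_measurable M"
      using random_variables[of 1] by simp
    show "(\<lambda>\<omega>. \<Prod>i<m. ?g i (D i \<omega>)) \<in> borel_measurable M"
      using D_meas by (intro borel_measurable_prod_ennreal) auto
    show "AE \<omega> in M. ennreal (exp (r * X 1 \<omega> - L r)) = (\<Prod>i<m. ?g i (D i \<omega>))"
    proof (rule AE_I2)
      fix \<omega> assume \<omega>: "\<omega> \<in> space M"
      have "(\<Sum>i<m. r * D i \<omega> - (s (Suc i) - s i) * L r) =
          r * (\<Sum>i<m. X (s (Suc i)) \<omega> - X (s i) \<omega>) - (\<Sum>i<m. s (Suc i) - s i) * L r"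
        by (simp only: D_def sum_subtractf[of "\<lambda>i. r * D' i" for D'] sum_distrib_left sum_distrib_right)
      also have "\<dots> = r * X 1 \<omega> - L r"
        using start_zero[OF \<omega>] s0 sm
        by (simp only: sum_lessThan_telescope[of "\<lambda>i. X (s i) \<omega>"] sum_lessThan_telescope[of s]) simp
      finally show "ennreal (exp (r * X 1 \<omega> - L r)) = (\<Prod>i<m. ?g i (D i \<omega>))"
        by (simp add: prod_ennreal exp_sum[symmetric])
    qed
  qed
  have ne: "finite {..<m}" "{..<m} \<noteq> {}" using m by auto
  show "prob_space (esscher r)"
    by (rule prob_space_product_density[OF ne indep _ _ Q]) (use norm in auto)
  show "prob_space.indep_vars (esscher r) (\<lambda>_. borel) D {..<m}"
    by (rule indep_vars_product_density[OF ne indep _ _ Q]) (use norm in auto)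
  show "distr (esscher r) borel (D i) = density (distr M borel (X (s (Suc i) - s i))) (?g i)"
    if "i < m" for i
    unfolding D[OF that, symmetric]
    by (rule distr_product_density[OF ne indep _ _ Q]) (use norm that in auto)
qed

lemma prob_space_esscher: "prob_space (esscher r)"
  by (rule prob_space_esscher_partition[of 1 "\<lambda>i. real i"]) auto

lemma distr_esscher_increment:
  assumes "0 \<le> s" "s \<le> t" "t \<le> 1"
  shows "distr (esscher r) borel (\<lambda>\<omega>. X t \<omega> - X s \<omega>) =
    density (distr M borel (X (t - s))) (\<lambda>x. ennreal (exp (r * x - (t - s) * L r)))"
proof -
  \<comment> \<open>The partition is \<open>0, s, t, 1\<close>, possibly with repeated points; the
    increment in question has index 1.\<close>
  let ?s = "\<lambda>i::nat. if i = 0 then 0 else if i = 1 then s else if i = 2 then t else 1"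
  show ?thesis
    using distr_esscher_partition[of 3 ?s 1 r] assms by auto
qed

lemma distr_esscher:
  assumes "t \<in> {0..1}"
  shows "distr (esscher r) borel (X t) =
    density (distr M borel (X t)) (\<lambda>x. ennreal (exp (r * x - t * L r)))"
proof -
  have "distr (esscher r) borel (X t) = distr (esscher r) borel (\<lambda>\<omega>. X t \<omega> - X 0 \<omega>)"
    by (intro distr_cong) (auto simp: start_zero)
  then show ?thesis using distr_esscher_increment[of 0 t r] assms by simp
qed

lemma indep_increments_esscher:
  fixes t :: "nat \<Rightarrow> real"
  assumes "0 \<le> t 0" "\<forall>i<n. t i \<le> t (Suc i)" "t n \<le> 1"
  shows "prob_space.indep_vars (esscher r) (\<lambda>_. borel) (\<lambda>i \<omega>. X (t (Suc i)) \<omega> - X (t i) \<omega>) {..<n}"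
proof -
  interpret Q: prob_space "esscher r" by (rule prob_space_esscher)
  \<comment> \<open>The given times need not start at 0 or end at 1, so both endpoints are added.
    The original increments then have indices 1 to \<open>n\<close>; the outer two are dropped and
    the rest renumbered.\<close>
  let ?s = "\<lambda>i. case i of 0 \<Rightarrow> 0 | Suc j \<Rightarrow> if j \<le> n then t j else 1"
  let ?D = "\<lambda>i \<omega>. X (?s (Suc i)) \<omega> - X (?s i) \<omega>"
  have "Q.indep_vars (\<lambda>_. borel) ?D {..<Suc (Suc n)}"
  proof (rule indep_vars_esscher_partition)
    show "?s i \<le> ?s (Suc i)" if "i < Suc (Suc n)" for i
    proof (cases i)
      case (Suc j)
      then have "j < n \<or> j = n" using that by auto
      then show ?thesis using assms Suc by auto
    qed (use assms in simp)
  qed auto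
  then have "Q.indep_vars (\<lambda>_. borel) ?D (Suc ` {..<n})"
    by (rule Q.indep_vars_subset) auto
  then have "Q.indep_vars (\<lambda>_. borel) (\<lambda>i. ?D (Suc i)) {..<n}"
    by (rule Q.indep_vars_reindex[rotated]) simp
  then show ?thesis
    by (rule Q.indep_vars_cong[THEN iffD1, rotated -1]) auto
qed

text \<open>Multiplying \<open>iexp (v * x)\<close> by the tilt gives, up to a constant, the complex
  exponential with parameter \<open>r + \<i> v\<close>, whose integral is known.\<close>

lemma char_esscher:
  assumes t: "t \<in> {0..1}"
  shows "char (distr (esscher r) borel (X t)) v =
    exp (of_real t * (\<Lambda> (of_real r + \<i> * of_real v) - \<Lambda> (of_real r)))"
proof -
  have "char (distr (esscher r) borel (X t)) v =
      (LINT x|distr M borel (X t). exp (r * x - t * L r) *\<^sub>R iexp (v * x))"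
    unfolding distr_esscher[OF t] char_def by (rule integral_density) auto
  also have "\<dots> = (LINT x|distr M borel (X t).
      of_real (exp (- (t * L r))) * exp ((of_real r + \<i> * of_real v) * of_real x))"
  proof (intro Bochner_Integration.integral_cong refl)
    fix x
    have "complex_of_real (exp (r * x - t * L r)) * iexp (v * x) =
        exp (of_real (r * x - t * L r) + \<i> * of_real (v * x))"
      by (simp only: exp_add exp_of_real)
    also have "\<dots> = exp (of_real (- (t * L r)) + (of_real r + \<i> * of_real v) * of_real x)"
      by (simp add: algebra_simps)
    also have "\<dots> = of_real (exp (- (t * L r))) * exp ((of_real r + \<i> * of_real v) * of_real x)"
      by (simp only: exp_add exp_of_real)
    finally show "exp (r * x - t * L r) *\<^sub>R iexp (v * x) =
        of_real (exp (- (t * L r))) * exp ((of_real r + \<i> * of_real v) * of_real x)"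
      by (simp only: scaleR_conv_of_real)
  qed
  also have "\<dots> = of_real (exp (- (t * L r))) * exp (of_real t * \<Lambda> (of_real r + \<i> * of_real v))"
    by (simp only: integral_mult_right_zero integral_cexp_levy[OF t])
  also have "\<dots> = exp (of_real (- (t * L r)) + of_real t * \<Lambda> (of_real r + \<i> * of_real v))"
    by (simp only: exp_add exp_of_real)
  also have "\<dots> = exp (of_real t * (\<Lambda> (of_real r + \<i> * of_real v) - \<Lambda> (of_real r)))"
    by (simp add: \<Lambda>_of_real L_def algebra_simps)
  finally show ?thesis .
qed

text \<open>Cauchy-Schwarz for the density and the indicator of \<open>A\<close>. This quantitative
  absolute continuity carries convergence in probability over to the Esscher measure.\<close>

lemma measure_esscher_square_le:
  "\<exists>K\<ge>0. \<forall>A\<in>sets M. (measure (esscher r) A)\<^sup>2 \<le> K * measure M A"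
proof (intro exI conjI ballI)
  fix A assume A: "A \<in> sets M"
  interpret Q: prob_space "esscher r" by (rule prob_space_esscher)
  have X1[measurable]: "X 1 \<in> borel_measurable M" by (rule random_variables) simp
  let ?Y = "\<lambda>\<omega>. ennreal (exp (r * X 1 \<omega> - L r))"
  \<comment> \<open>This is the second moment of the density, finite because the exponential moment
    of order \<open>2 * r\<close> is.\<close>
  let ?K = "exp (L (2 * r) - 2 * L r)"
  have "(emeasure (esscher r) A)\<^sup>2 = (\<integral>\<^sup>+\<omega>. ?Y \<omega> * indicator A \<omega> \<partial>M)\<^sup>2"
    using A by (simp add: esscher_def emeasure_density)
  also have "\<dots> \<le> (\<integral>\<^sup>+\<omega>. ?Y \<omega> ^ 2 \<partial>M) * (\<integral>\<^sup>+\<omega>. indicator A \<omega> ^ 2 \<partial>M)"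
    using A by (intro Cauchy_Schwarz_nn_integral) auto
  also have "(\<integral>\<^sup>+\<omega>. ?Y \<omega> ^ 2 \<partial>M) = (\<integral>\<^sup>+\<omega>. ennreal (exp (2 * r * X 1 \<omega> - 2 * L r)) \<partial>M)"
    by (simp add: ennreal_power exp_double[symmetric] algebra_simps)
  also have "\<dots> = (\<integral>\<^sup>+x. ennreal (exp (2 * r * x - 2 * L r)) \<partial>distr M borel (X 1))"
    by (rule nn_integral_distr[symmetric]) auto
  also have "\<dots> = ennreal ?K"
    by (subst nn_integral_exp_levy) auto
  also have "(\<integral>\<^sup>+\<omega>. indicator A \<omega> ^ 2 \<partial>M) = emeasure M A"
    using A by (simp add: power2_eq_square indicator_inter_arith[symmetric])
  finally have "ennreal ((measure (esscher r) A)\<^sup>2) \<le> ennreal (?K * measure M A)"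
    by (simp add: Q.emeasure_eq_measure emeasure_eq_measure ennreal_power ennreal_mult)
  then show "(measure (esscher r) A)\<^sup>2 \<le> ?K * measure M A" by simp
qed simp

text \<open>Increments stay stationary because their tilted law depends only on the length of the
  time interval. Stochastic continuity follows by squeezing with
  \<open>sqrt (K * measure M A)\<close>; the paths are unchanged.\<close>

lemma levy_process_esscher: "levy_process (esscher r) X"
proof -
  interpret Q: prob_space "esscher r" by (rule prob_space_esscher)
  show ?thesis
  proof
    fix t :: real assume t: "t \<in> {0..1}"
    then show "X t \<in> borel_measurable (esscher r)"
      using random_variables by (simp add: measurable_def)
    fix \<epsilon> :: real assume \<epsilon>: "0 < \<epsilon>"
    let ?A = "\<lambda>s. {\<omega> \<in> space M. \<epsilon> < \<bar>X s \<omega> - X t \<omega>\<bar>}"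
    obtain K where K: "K \<ge> 0" "\<And>A. A \<in> sets M \<Longrightarrow> (measure (esscher r) A)\<^sup>2 \<le> K * measure M A"
      using measure_esscher_square_le by blast
    have "((\<lambda>s. measure (esscher r) (?A s)) \<longlongrightarrow> 0) (at t within {0..1})"
    proof (rule tendsto_sandwich[OF _ _ tendsto_const])
      have "((\<lambda>s. sqrt (K * measure M (?A s))) \<longlongrightarrow> sqrt (K * 0)) (at t within {0..1})"
        by (intro tendsto_real_sqrt tendsto_mult tendsto_const stochastically_continuous t \<epsilon>)
      then show "((\<lambda>s. sqrt (K * measure M (?A s))) \<longlongrightarrow> 0) (at t within {0..1})" by simp
      have "measure (esscher r) (?A s) \<le> sqrt (K * measure M (?A s))" if "s \<in> {0..1}" for s
      proof -
        have [measurable]: "X s \<in> borel_measurable M" "X t \<in> borel_measurable M"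
          using random_variables that t by auto
        have "?A s \<in> sets M" by measurable
        then show ?thesis by (intro real_le_rsqrt K(2))
      qed
      then show "eventually (\<lambda>s. measure (esscher r) (?A s) \<le> sqrt (K * measure M (?A s))) (at t within {0..1})"
        by (auto simp: eventually_at_filter)
    qed (auto intro: always_eventually)
    then show "((\<lambda>s. measure (esscher r) {\<omega> \<in> space (esscher r). \<epsilon> < \<bar>X s \<omega> - X t \<omega>\<bar>}) \<longlongrightarrow> 0)
        (at t within {0..1})" by simp
  next
    fix s h :: real assume "0 \<le> s" "0 \<le> h" "s + h \<le> 1"
    then show "distr (esscher r) borel (\<lambda>\<omega>. X (s + h) \<omega> - X s \<omega>) =
        distr (esscher r) borel (\<lambda>\<omega>. X h \<omega> - X 0 \<omega>)"
      using distr_esscher_increment[of s "s + h" r] distr_esscher_increment[of 0 h r] by simp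
  qed (use indep_increments_esscher start_zero cadlag_paths in auto)
qed

section \<open>The exponent after tilting and the martingale property\<close>

lemma integrable_first_order_remainder:
  "integrable \<nu> (\<lambda>x. of_real x * (exp (of_real r * complex_of_real x) - 1))"
proof -
  let ?R = "\<lambda>x. exp (of_real r * complex_of_real x) - 1 - of_real r * complex_of_real x"
  have "norm (of_real x * (exp (of_real r * complex_of_real x) - 1)) \<le> norm (?R x) + \<bar>r\<bar> * x\<^sup>2"
    if "\<bar>x\<bar> \<le> 1" for x
  proof -
    \<comment> \<open>Splitting off the linear part of \<open>exp\<close> leaves \<open>x\<close>
      times the integrable remainder, harmless for \<open>\<bar>x\<bar> \<le> 1\<close>, and a
      multiple of the integrable square.\<close>
    have "of_real x * (exp (of_real r * complex_of_real x) - 1) = of_real x * ?R x + of_real (r * x\<^sup>2)"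
      by (simp add: algebra_simps power2_eq_square)
    then have "norm (of_real x * (exp (of_real r * complex_of_real x) - 1))
        \<le> norm (of_real x * ?R x) + norm (complex_of_real (r * x\<^sup>2))"
      by (metis norm_triangle_ineq)
    also have "\<dots> \<le> norm (?R x) + \<bar>r\<bar> * x\<^sup>2"
      using mult_right_mono[OF that norm_ge_zero[of "?R x"]]
      by (simp only: norm_mult norm_of_real abs_mult abs_power2)
    finally show ?thesis .
  qed
  then have "AE x in \<nu>. norm (of_real x * (exp (of_real r * complex_of_real x) - 1)) \<le>
      norm (norm (?R x) + \<bar>r\<bar> * x\<^sup>2)"
    using bounded_jumps by (auto elim!: eventually_mono)
  moreover have "integrable \<nu> (\<lambda>x. norm (?R x) + \<bar>r\<bar> * x\<^sup>2)"
    using integrable_exp_remainder integrable_square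
    by (intro Bochner_Integration.integrable_add integrable_norm integrable_mult_right)
  ultimately show ?thesis
    by (rule Bochner_Integration.integrable_bound[rotated 2]) measurable
qed

text \<open>Along the real axis \<open>\<Lambda>\<close> is \<open>levy_log_mgf\<close>, so
  uniqueness of the derivative identifies the explicit complex derivative with 0.\<close>

lemma \<Lambda>_deriv_eq_0_of_critical:
  assumes "(levy_log_mgf \<nu> \<sigma>2 b has_real_derivative 0) (at r)"
  shows "of_real \<sigma>2 * of_real r + of_real b +
    (LINT x|\<nu>. of_real x * (exp (of_real r * complex_of_real x) - 1)) = 0" (is "?D = 0")
proof -
  have "((\<lambda>x. \<Lambda> (of_real x)) has_vector_derivative ?D) (at r)"
    using has_field_derivative_\<Lambda> by (rule has_vector_derivative_real_field)
  moreover have "((\<lambda>x. of_real (levy_log_mgf \<nu> \<sigma>2 b x)) has_vector_derivative of_real 0) (at r)"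
    using assms by (intro has_vector_derivative_of_real) (simp add: has_real_derivative_iff_has_vector_derivative)
  ultimately show ?thesis
    unfolding \<Lambda>_of_real by (metis vector_derivative_unique_at of_real_0)
qed

lemma levy_martingale_exponent_tilted:
  assumes "(levy_log_mgf \<nu> \<sigma>2 b has_real_derivative 0) (at r)"
  shows "levy_martingale_exponent (density \<nu> (\<lambda>x. ennreal (exp (r * x)))) \<sigma>2 v =
    - (\<Lambda> (of_real r + \<i> * of_real v) - \<Lambda> (of_real r))"
proof -
  let ?r = "complex_of_real r" and ?v = "\<i> * complex_of_real v"
  let ?F = "\<lambda>z x. exp (z * complex_of_real x) - 1 - z * complex_of_real x"
  let ?G = "\<lambda>x. of_real x * (exp (?r * complex_of_real x) - 1)"
  have "(LINT x|density \<nu> (\<lambda>x. ennreal (exp (r * x))). 1 - iexp (v * x) + \<i> * of_real (v * x)) =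
      (LINT x|\<nu>. exp (r * x) *\<^sub>R (1 - iexp (v * x) + \<i> * of_real (v * x)))"
    by (rule integral_density) auto
  \<comment> \<open>The first two terms are the integrands of \<open>\<Lambda>\<close> at
    \<open>r\<close> and \<open>r + \<i> v\<close>; the third corrects the compensator from
    \<open>x\<close> to \<open>x * exp (r * x)\<close>.\<close>
  also have "\<dots> = (LINT x|\<nu>. ?F ?r x - ?F (?r + ?v) x + ?v * ?G x)"
  proof (intro Bochner_Integration.integral_cong refl)
    fix x
    have "exp ((?r + ?v) * complex_of_real x) = exp (?r * complex_of_real x) * exp (?v * complex_of_real x)"
      by (simp add: exp_add[symmetric] algebra_simps)
    moreover have "complex_of_real (exp (r * x)) = exp (?r * complex_of_real x)"
      by (simp add: exp_of_real[symmetric] del: exp_of_real)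
    ultimately show "exp (r * x) *\<^sub>R (1 - iexp (v * x) + \<i> * of_real (v * x)) =
        ?F ?r x - ?F (?r + ?v) x + ?v * ?G x"
      by (simp add: scaleR_conv_of_real algebra_simps)
  qed
  also have "\<dots> = (LINT x|\<nu>. ?F ?r x) - (LINT x|\<nu>. ?F (?r + ?v) x) + ?v * (LINT x|\<nu>. ?G x)"
    by (simp only: Bochner_Integration.integral_add Bochner_Integration.integral_diff
        Bochner_Integration.integrable_diff integrable_mult_right integral_mult_right_zero
        integrable_exp_remainder integrable_first_order_remainder)
  \<comment> \<open>Criticality enters here: the correction integral is minus the derivative of the
    quadratic and linear part at \<open>r\<close>.\<close>
  also have "(LINT x|\<nu>. ?G x) = - (of_real \<sigma>2 * ?r + of_real b)"
    using \<Lambda>_deriv_eq_0_of_critical[OF assms] by (subst eq_neg_iff_add_eq_0) (simp only: ac_simps)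
  finally have I: "(LINT x|density \<nu> (\<lambda>x. ennreal (exp (r * x))). 1 - iexp (v * x) + \<i> * of_real (v * x)) =
      (LINT x|\<nu>. ?F ?r x) - (LINT x|\<nu>. ?F (?r + ?v) x) + ?v * - (of_real \<sigma>2 * ?r + of_real b)" .
  \<comment> \<open>With \<open>c\<close> and \<open>d\<close> for the two remainder integrals, what
    is left is a polynomial identity in which the terms linear in \<open>v\<close> cancel.\<close>
  have "of_real (\<sigma>2 / 2 * v\<^sup>2) + (c - d + ?v * - (of_real \<sigma>2 * ?r + of_real b)) =
      - ((of_real (\<sigma>2 / 2) * (?r + ?v)\<^sup>2 + of_real b * (?r + ?v) + d) -
        (of_real (\<sigma>2 / 2) * ?r\<^sup>2 + of_real b * ?r + c))" for c d
    by (simp add: power2_sum power_mult_distrib field_simps)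
  then show ?thesis
    unfolding levy_martingale_exponent_def \<Lambda>_def I .
qed

lemma levy_martingale_esscher:
  assumes "(levy_log_mgf \<nu> \<sigma>2 b has_real_derivative 0) (at r)"
  shows "levy_martingale (esscher r) X (density \<nu> (\<lambda>x. ennreal (exp (r * x)))) \<sigma>2"
proof -
  interpret Q: levy_process "esscher r" X by (rule levy_process_esscher)
  show ?thesis
  proof
    have "{0} \<in> null_sets \<nu>"
      using levy_measure(1) by (auto simp: measure_off_zero_def null_sets_def)
    then have "{0} \<in> null_sets (density \<nu> (\<lambda>x. ennreal (exp (r * x))))"
      using AE_not_in[of "{0}" \<nu>] by (simp add: null_sets_density_iff)
    then show "measure_off_zero (density \<nu> (\<lambda>x. ennreal (exp (r * x))))"
      by (simp add: measure_off_zero_def null_sets_def)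
    have "(\<integral>\<^sup>+x. ennreal (min \<bar>x\<bar> (x\<^sup>2)) \<partial>density \<nu> (\<lambda>x. ennreal (exp (r * x)))) =
        (\<integral>\<^sup>+x. ennreal (exp (r * x)) * ennreal (min \<bar>x\<bar> (x\<^sup>2)) \<partial>\<nu>)"
      by (rule nn_integral_density) auto
    \<comment> \<open>For bounded jumps the tilt is at most \<open>exp \<bar>r\<bar>\<close>, so the
      second moment of \<open>\<nu>\<close> controls the tilted measure.\<close>
    also have "\<dots> \<le> (\<integral>\<^sup>+x. ennreal (exp \<bar>r\<bar> * x\<^sup>2) \<partial>\<nu>)"
    proof (rule nn_integral_mono_AE)
      show "AE x in \<nu>. ennreal (exp (r * x)) * ennreal (min \<bar>x\<bar> (x\<^sup>2)) \<le> ennreal (exp \<bar>r\<bar> * x\<^sup>2)"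
        using bounded_jumps
      proof eventually_elim
        case (elim x)
        have "r * x \<le> \<bar>r\<bar> * \<bar>x\<bar>" by (metis abs_ge_self abs_mult)
        also have "\<dots> \<le> \<bar>r\<bar>" using elim by (simp add: mult_left_le)
        finally have "exp (r * x) * min \<bar>x\<bar> (x\<^sup>2) \<le> exp \<bar>r\<bar> * x\<^sup>2"
          by (intro mult_mono) auto
        then show ?case by (simp add: ennreal_mult[symmetric])
      qed
    qed
    also have "\<dots> < \<infinity>"
      using integrable_square by (subst nn_integral_eq_integral) auto
    finally show "(\<integral>\<^sup>+x. ennreal (min \<bar>x\<bar> (x\<^sup>2)) \<partial>density \<nu> (\<lambda>x. ennreal (exp (r * x)))) < \<infinity>" .
    fix t v :: real assume "t \<in> {0..1}"
    from char_esscher[OF this]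
    show "char (distr (esscher r) borel (X t)) v =
        exp (- (of_real t * levy_martingale_exponent (density \<nu> (\<lambda>x. ennreal (exp (r * x)))) \<sigma>2 v))"
      by (simp only: levy_martingale_exponent_tilted[OF assms] mult_minus_right minus_minus)
  qed (rule variance_nonneg)
qed

section \<open>Comparison of small ball probabilities\<close>

lemma
  fixes \<epsilon> r :: real
  defines "A \<equiv> {\<omega> \<in> space M. sup_norm X \<omega> \<le> \<epsilon>}"
  shows small_ball_esscher_le: "exp (L r - \<epsilon> * \<bar>r\<bar>) * measure (esscher r) A \<le> measure M A"
    and small_ball_le_esscher: "measure M A \<le> exp (L r + \<epsilon> * \<bar>r\<bar>) * measure (esscher r) A"
proof -
  interpret Q: prob_space "esscher r" by (rule prob_space_esscher)
  have "exp (L r - \<epsilon> * \<bar>r\<bar>) * measure (esscher r) A \<le> measure M A \<and>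
    measure M A \<le> exp (L r + \<epsilon> * \<bar>r\<bar>) * measure (esscher r) A"
  proof (cases "A \<in> sets M")
    case False \<comment> \<open>both measures take the junk value 0 on a non-measurable set\<close>
    then show ?thesis by (simp add: measure_notin_sets)
  next
    case True
    have [measurable]: "X 1 \<in> borel_measurable M" by (rule random_variables) simp
    let ?Y = "\<lambda>\<omega>. ennreal (exp (r * X 1 \<omega> - L r))"
    \<comment> \<open>The density involves the path only through its value at time 1, which the
      supremum norm bounds. Integrating the resulting two-sided bound over \<open>A\<close> yields
      both inequalities.\<close>
    have X1: "\<bar>r * X 1 \<omega>\<bar> \<le> \<epsilon> * \<bar>r\<bar>" if "\<omega> \<in> A" for \<omega>
    proof -
      have "\<bar>X 1 \<omega>\<bar> \<le> \<epsilon>"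
        using that cadlag_paths[of \<omega>] abs_le_sup_norm[of X \<omega> 1] by (auto simp: A_def)
      then show ?thesis
        using mult_right_mono[of "\<bar>X 1 \<omega>\<bar>" \<epsilon> "\<bar>r\<bar>"] by (simp add: abs_mult mult.commute)
    qed
    have Q: "emeasure (esscher r) A = (\<integral>\<^sup>+\<omega>. ?Y \<omega> * indicator A \<omega> \<partial>M)"
      using True by (simp add: esscher_def emeasure_density)
    have const: "(\<integral>\<^sup>+\<omega>. ennreal c * indicator A \<omega> \<partial>M) = ennreal c * emeasure M A" for c
      using True by (rule nn_integral_cmult_indicator)
    have "emeasure (esscher r) A \<le> ennreal (exp (\<epsilon> * \<bar>r\<bar> - L r)) * emeasure M A"
      unfolding Q const[symmetric] using X1
      by (intro nn_integral_mono) (force split: split_indicator intro!: ennreal_leI)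
    then have 1: "measure (esscher r) A \<le> exp (\<epsilon> * \<bar>r\<bar> - L r) * measure M A"
      by (simp add: Q.emeasure_eq_measure emeasure_eq_measure ennreal_mult[symmetric])
    have "ennreal (exp (- (\<epsilon> * \<bar>r\<bar>) - L r)) * emeasure M A \<le> emeasure (esscher r) A"
      unfolding Q const[symmetric] using X1
      by (intro nn_integral_mono) (force split: split_indicator intro!: ennreal_leI)
    then have 2: "exp (- (\<epsilon> * \<bar>r\<bar>) - L r) * measure M A \<le> measure (esscher r) A"
      by (simp add: Q.emeasure_eq_measure emeasure_eq_measure ennreal_mult[symmetric])
    have "exp (L r - \<epsilon> * \<bar>r\<bar>) * measure (esscher r) A \<le> exp (L r - \<epsilon> * \<bar>r\<bar>) * (exp (\<epsilon> * \<bar>r\<bar> - L r) * measure M A)"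
      using 1 by (rule mult_left_mono) simp
    moreover have "exp (L r + \<epsilon> * \<bar>r\<bar>) * (exp (- (\<epsilon> * \<bar>r\<bar>) - L r) * measure M A) \<le> exp (L r + \<epsilon> * \<bar>r\<bar>) * measure (esscher r) A"
      using 2 by (rule mult_left_mono) simp
    ultimately show ?thesis
      by (simp add: mult.assoc[symmetric] exp_add[symmetric])
  qed
  then show "exp (L r - \<epsilon> * \<bar>r\<bar>) * measure (esscher r) A \<le> measure M A"
    "measure M A \<le> exp (L r + \<epsilon> * \<bar>r\<bar>) * measure (esscher r) A" by auto
qed

end

theorem proposition1p3:
  fixes P Q :: "'a measure"
    and X :: "real \<Rightarrow> 'a \<Rightarrow> real"
    and \<nu> :: "real measure"
    and \<sigma>2 b u :: real
  assumes levy: "levy_process_with_triplet P X \<nu> \<sigma>2 b"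
    and nondeterministic: "\<not> deterministic_process P X"
    and support: "measure_support \<nu> \<subseteq> {x. \<bar>x\<bar> \<le> 1}"
    and critical: "(levy_log_mgf \<nu> \<sigma>2 b has_real_derivative 0) (at u)"
    and Q_eq: "Q = density P (\<lambda>\<omega>. ennreal (exp (u * X 1 \<omega> - levy_log_mgf \<nu> \<sigma>2 b u)))"
  shows "prob_space Q \<and>
    (\<forall>\<epsilon>>0.
       exp (levy_log_mgf \<nu> \<sigma>2 b u - \<epsilon> * \<bar>u\<bar>) * measure Q {\<omega> \<in> space Q. sup_norm X \<omega> \<le> \<epsilon>}
         \<le> measure P {\<omega> \<in> space P. sup_norm X \<omega> \<le> \<epsilon>} \<and>
       measure P {\<omega> \<in> space P. sup_norm X \<omega> \<le> \<epsilon>}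
         \<le> exp (levy_log_mgf \<nu> \<sigma>2 b u + \<epsilon> * \<bar>u\<bar>) * measure Q {\<omega> \<in> space Q. sup_norm X \<omega> \<le> \<epsilon>}) \<and>
    levy_martingale Q X (density \<nu> (\<lambda>x. ennreal (exp (u * x)))) \<sigma>2"
proof -
  interpret levy_process_with_triplet P X \<nu> \<sigma>2 b by (rule levy)
  have "AE x in \<nu>. x \<in> {x. \<bar>x\<bar> \<le> 1}"
    using levy_measure(1) support
    by (intro AE_in_of_measure_support_subset) (simp_all add: measure_off_zero_def)
  then interpret levy_process_bounded_jumps P X \<nu> \<sigma>2 b by unfold_locales simp
  have Q: "Q = esscher u" by (simp add: Q_eq esscher_def L_def)
  show ?thesis
    using prob_space_esscher small_ball_esscher_le[of u] small_ball_le_esscher[of _ u]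
      levy_martingale_esscher[OF critical]
    by (simp add: Q L_def)
qed

end
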